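(* Let $K$ be a field of characteristic $0$, let $\Sigma$ be a monoidal signature, and let $\mathbf{Dot}(\Sigma)$ be the hypergraph category of dot-diagrams over $\Sigma$. Let $F, G : A \to B$ be two morphisms of $\mathbf{Dot}(\Sigma)$ with the same domain and codomain. Then $F = G$ if and only if for all hypergraph functors $\llbracket - \rrbracket : \mathbf{Dot}(\Sigma) \to \mathbf{Mat}(K)$ one has $\llbracket F \rrbracket = \llbracket G \rrbracket$.
   Context: **Signature.** A monoidal signature $\Sigma$ consists of a set $\mathrm{Obj}$, a set $\mathrm{Mor}$, and functions $\mathrm{dom},\mathrm{cod}:\mathrm{Mor}\to\mathrm{Obj}^*$ (finite words). For a word $w$, $|w|$ is its length and $w[i]$ its $i$-th letter. **SCFA.** A special commutative Frobenius algebra (SCFA) on an object $A$ of a symmetric monoidal category with symmetry $\gamma$ is a tuple $(A,\mu:A\otimes A\to A,\eta:I\to A,\delta:A\to A\otimes A,\epsilon:A\to I)$ such that $(\mu,\eta)$ is a commutative monoid, $(\delta,\epsilon)$ is a cocommutative comonoid, $(1_A\otimes\mu)\circ(\delta\otimes 1_A)=\delta\circ\mu$, and $\mu\circ\delta=1_A$. **Hypergraph category.** A symmetric monoidal category in which every object is equipped with a chosen SCFA, such that the SCFA chosen on $A\otimes B$ is the product of those on $A$ and $B$ (so $\mu_{A\otimes B}=(\mu_A\otimes\mu_B)\circ(1_A\otimes\gamma_{B,A}\otimes 1_B)$, $\eta_{A\otimes B}=\eta_A\otimes\eta_B$, and dually for $\delta,\epsilon$). **Hypergraph functor.** A strong symmetric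 monoidal functor $F$ with natural isomorphisms $p_{A,B}:F(A\otimes B)\to FA\otimes FB$ and an isomorphism $u:FI\to I$ (satisfying the usual associativity, unit and symmetry coherence conditions) such that $F(\mu_A)=\mu_{FA}\circ p_{A,A}$, $F(\eta_A)=\eta_{FA}\circ u$, $p_{A,A}\circ F(\delta_A)=\delta_{FA}$, $u\circ F(\epsilon_A)=\epsilon_{FA}$. **Dot-diagrams.** A dot-diagram $F$ over $\Sigma$ consists of: a finite set $B^F$ (boxes), a finite set $D^F$ (dots), sets $I^F=\{\mathrm{in}_1,\dots,\mathrm{in}_m\}$ and $O^F=\{\mathrm{out}_1,\dots,\mathrm{out}_n\}$ (diagram inputs and outputs), labelling functions $\ell_b^F:B^F\to\mathrm{Mor}$ and $\ell_d^F:D^F\to\mathrm{Obj}$, and wiring functions $\theta_{\mathrm{in}}^F:\mathrm{Inputs}^F\to D^F$, $\theta_{\mathrm{out}}^F:\mathrm{Outputs}^F\to D^F$, where $\mathrm{Inputs}^F=\{(b,i): b\in B^F, 1\le i\le|\mathrm{dom}(\ell_b^F(b))|\}+I^F$ and $\mathrm{Outputs}^F=\{(j,b): b\in B^F, 1\le j\le|\mathrm{cod}(\ell_b^F(b))|\}+O^F$, subject to $\ell_d^F(\theta_{\mathrm{in}}^F(b,i))=\mathrm{dom}(\ell_b^F(b))[i]$ and $\ell_d^F(\theta_{\mathrm{out}}^F(j,b))=\mathrm{cod}(\ell_b^F(b))[j]$. A homomorphism $\Phi:F\to G$ of dot-diagrams with $I^F=I^G$, $O^F=O^G$ is a pair of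 functions $\Phi_b:B^F\to B^G$, $\Phi_d:D^F\to D^G$ with $\ell_b^G(\Phi_b(b))=\ell_b^F(b)$, $\ell_d^G(\Phi_d(d))=\ell_d^F(d)$, $\theta_{\mathrm{in}}^G(\Phi_b(b),i)=\Phi_d(\theta_{\mathrm{in}}^F(b,i))$, $\theta_{\mathrm{out}}^G(j,\Phi_b(b))=\Phi_d(\theta_{\mathrm{out}}^F(j,b))$, $\theta_{\mathrm{in}}^G(\mathrm{in}_i)=\Phi_d(\theta_{\mathrm{in}}^F(\mathrm{in}_i))$, $\theta_{\mathrm{out}}^G(\mathrm{out}_j)=\Phi_d(\theta_{\mathrm{out}}^F(\mathrm{out}_j))$. An isomorphism is an invertible homomorphism. **The category $\mathbf{Dot}(\Sigma)$.** Objects are words in $\mathrm{Obj}^*$. Morphisms $v\to w$ are isomorphism classes of dot-diagrams with $|v|$ inputs and $|w|$ outputs such that $\ell_d(\theta_{\mathrm{in}}(\mathrm{in}_i))=v[i]$ and $\ell_d(\theta_{\mathrm{out}}(\mathrm{out}_j))=w[j]$. The composite $G\circ F$ has boxes $B^F+B^G$, inputs $I^F$, outputs $O^G$, and dots the pushout of $D^F\xleftarrow{\theta_{\mathrm{out}}^F}O^F\cong I^G\xrightarrow{\theta_{\mathrm{in}}^G}D^G$ in sets, with induced labellings and with wiring obtained by composing $\theta^F+\theta^G$ with the quotient map $D^F+D^G\to D^{G\circ F}$. The monoidal product is concatenation of words and disjoint union of diagrams (the inputs/outputs of the second diagram placed after those of the first); the unit object $I$ is the empty word. Identities and swaps have no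 boxes and one dot per letter, with each dot connected to the evident input and output. For a letter $A$, $\mu_A,\eta_A,\delta_A,\epsilon_A$ are the box-free diagrams with a single dot labelled $A$ connected to respectively $2,0,1,1$ diagram inputs and $1,1,2,0$ diagram outputs; on words the SCFA is the product one. **The category $\mathbf{Mat}(K)$.** Objects are finite sets; a morphism $\psi:\mathcal I\to\mathcal J$ is a family $(\psi_i^j)_{i\in\mathcal I,j\in\mathcal J}$ of elements of $K$; $(g\circ f)_i^k=\sum_j f_i^jg_j^k$, identities are Kronecker deltas. The monoidal product is $\mathcal I\otimes\mathcal J=\mathcal I\times\mathcal J$ with $(\psi\otimes\phi)_{(i,j)}^{(k,l)}=\psi_i^k\phi_j^l$, the unit is a one-element set, and the structural isomorphisms are the evident permutation matrices. The SCFA on $\mathcal I$ is: $\mu_{ij}^k=1$ if $i=j=k$ and $0$ otherwise; $\delta_i^{jk}=1$ if $i=j=k$ and $0$ otherwise; $\eta^i=1$; $\epsilon_i=1$. *)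

theory Defs
  imports Complex_Main "HOL-Library.FuncSet"
begin

section \<open>Hypergraph structure and hypergraph functors\<close>

text \<open>
  The operations of a hypergraph category. The composite of \<open>f : A \<rightarrow> B\<close> and \<open>g : B \<rightarrow> C\<close>
  is \<open>Comp \<C> g f\<close>. The structural isomorphisms have the directions
  \<open>(A \<otimes> B) \<otimes> C \<rightarrow> A \<otimes> (B \<otimes> C)\<close>, \<open>I \<otimes> A \<rightarrow> A\<close>, \<open>A \<otimes> I \<rightarrow> A\<close> and \<open>A \<otimes> B \<rightarrow> B \<otimes> A\<close>.
\<close>

record ('o, 'a) hypergraph_structure =
  Ob :: "'o set"
  Hom :: "'o \<Rightarrow> 'o \<Rightarrow> 'a set"
  Id :: "'o \<Rightarrow> 'a"
  Comp :: "'a \<Rightarrow> 'a \<Rightarrow> 'a"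
  TensorO :: "'o \<Rightarrow> 'o \<Rightarrow> 'o"
  Tensor :: "'a \<Rightarrow> 'a \<Rightarrow> 'a"
  UnitO :: "'o"
  Assoc :: "'o \<Rightarrow> 'o \<Rightarrow> 'o \<Rightarrow> 'a"
  LUnit :: "'o \<Rightarrow> 'a"
  RUnit :: "'o \<Rightarrow> 'a"
  Sym :: "'o \<Rightarrow> 'o \<Rightarrow> 'a"
  Mu :: "'o \<Rightarrow> 'a"
  Eta :: "'o \<Rightarrow> 'a"
  Delta :: "'o \<Rightarrow> 'a"
  Epsilon :: "'o \<Rightarrow> 'a"

definition iso_in :: "('o, 'a) hypergraph_structure \<Rightarrow> 'o \<Rightarrow> 'o \<Rightarrow> 'a \<Rightarrow> bool" where
  "iso_in \<C> A B f \<longleftrightarrow> f \<in> Hom \<C> A B \<and>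
     (\<exists>g \<in> Hom \<C> B A. Comp \<C> g f = Id \<C> A \<and> Comp \<C> f g = Id \<C> B)"

text \<open>
  \<open>PIso F A B\<close> is the comparison \<open>F (A \<otimes> B) \<rightarrow> F A \<otimes> F B\<close> and \<open>UIso F\<close> is \<open>F I \<rightarrow> I\<close>.
\<close>

record ('o, 'a, 'o2, 'a2) functor_data =
  OnOb :: "'o \<Rightarrow> 'o2"
  OnArr :: "'a \<Rightarrow> 'a2"
  PIso :: "'o \<Rightarrow> 'o \<Rightarrow> 'a2"
  UIso :: "'a2"

locale is_functor =
  fixes \<C> :: "('o, 'a) hypergraph_structure"
    and \<D> :: "('o2, 'a2) hypergraph_structure"
    and F :: "('o, 'a, 'o2, 'a2) functor_data"
  assumes on_ob: "A \<in> Ob \<C> \<Longrightarrow> OnOb F A \<in> Ob \<D>"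
    and on_arr: "\<lbrakk>A \<in> Ob \<C>; B \<in> Ob \<C>; f \<in> Hom \<C> A B\<rbrakk>
      \<Longrightarrow> OnArr F f \<in> Hom \<D> (OnOb F A) (OnOb F B)"
    and on_id: "A \<in> Ob \<C> \<Longrightarrow> OnArr F (Id \<C> A) = Id \<D> (OnOb F A)"
    and on_comp: "\<lbrakk>A \<in> Ob \<C>; B \<in> Ob \<C>; C \<in> Ob \<C>; f \<in> Hom \<C> A B; g \<in> Hom \<C> B C\<rbrakk>
      \<Longrightarrow> OnArr F (Comp \<C> g f) = Comp \<D> (OnArr F g) (OnArr F f)"

locale strong_symmetric_monoidal_functor = is_functor +
  assumes p_iso: "\<lbrakk>A \<in> Ob \<C>; B \<in> Ob \<C>\<rbrakk>
      \<Longrightarrow> iso_in \<D> (OnOb F (TensorO \<C> A B)) (TensorO \<D> (OnOb F A) (OnOb F B)) (PIso F A B)"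
    and u_iso: "iso_in \<D> (OnOb F (UnitO \<C>)) (UnitO \<D>) (UIso F)"
    and p_natural: "\<lbrakk>A \<in> Ob \<C>; A' \<in> Ob \<C>; B \<in> Ob \<C>; B' \<in> Ob \<C>; f \<in> Hom \<C> A A'; g \<in> Hom \<C> B B'\<rbrakk>
      \<Longrightarrow> Comp \<D> (PIso F A' B') (OnArr F (Tensor \<C> f g))
        = Comp \<D> (Tensor \<D> (OnArr F f) (OnArr F g)) (PIso F A B)"
    and coh_assoc: "\<lbrakk>A \<in> Ob \<C>; B \<in> Ob \<C>; C \<in> Ob \<C>\<rbrakk>
      \<Longrightarrow> Comp \<D> (Assoc \<D> (OnOb F A) (OnOb F B) (OnOb F C))
            (Comp \<D> (Tensor \<D> (PIso F A B) (Id \<D> (OnOb F C))) (PIso F (TensorO \<C> A B) C))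
        = Comp \<D> (Tensor \<D> (Id \<D> (OnOb F A)) (PIso F B C))
            (Comp \<D> (PIso F A (TensorO \<C> B C)) (OnArr F (Assoc \<C> A B C)))"
    and coh_lunit: "A \<in> Ob \<C>
      \<Longrightarrow> OnArr F (LUnit \<C> A)
        = Comp \<D> (LUnit \<D> (OnOb F A))
            (Comp \<D> (Tensor \<D> (UIso F) (Id \<D> (OnOb F A))) (PIso F (UnitO \<C>) A))"
    and coh_runit: "A \<in> Ob \<C>
      \<Longrightarrow> OnArr F (RUnit \<C> A)
        = Comp \<D> (RUnit \<D> (OnOb F A))
            (Comp \<D> (Tensor \<D> (Id \<D> (OnOb F A)) (UIso F)) (PIso F A (UnitO \<C>)))"
    and coh_sym: "\<lbrakk>A \<in> Ob \<C>; B \<in> Ob \<C>\<rbrakk>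
      \<Longrightarrow> Comp \<D> (PIso F B A) (OnArr F (Sym \<C> A B))
        = Comp \<D> (Sym \<D> (OnOb F A) (OnOb F B)) (PIso F A B)"

locale hypergraph_functor = strong_symmetric_monoidal_functor +
  assumes on_mu: "A \<in> Ob \<C> \<Longrightarrow> OnArr F (Mu \<C> A) = Comp \<D> (Mu \<D> (OnOb F A)) (PIso F A A)"
    and on_eta: "A \<in> Ob \<C> \<Longrightarrow> OnArr F (Eta \<C> A) = Comp \<D> (Eta \<D> (OnOb F A)) (UIso F)"
    and on_delta: "A \<in> Ob \<C> \<Longrightarrow> Comp \<D> (PIso F A A) (OnArr F (Delta \<C> A)) = Delta \<D> (OnOb F A)"
    and on_epsilon: "A \<in> Ob \<C> \<Longrightarrow> Comp \<D> (UIso F) (OnArr F (Epsilon \<C> A)) = Epsilon \<D> (OnOb F A)"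


section \<open>Signatures and dot-diagrams\<close>

record ('o, 'm) signature =
  SObj :: "'o set"
  SMor :: "'m set"
  SDom :: "'m \<Rightarrow> 'o list"
  SCod :: "'m \<Rightarrow> 'o list"

definition monoidal_signature :: "('o, 'm) signature \<Rightarrow> bool" where
  "monoidal_signature \<Sigma> \<longleftrightarrow>
     (\<forall>f \<in> SMor \<Sigma>. SDom \<Sigma> f \<in> lists (SObj \<Sigma>) \<and> SCod \<Sigma> f \<in> lists (SObj \<Sigma>))"

text \<open>
  All positions are counted from 0. The diagram inputs and outputs are \<open>0, \<dots>, NIn - 1\<close> and
  \<open>0, \<dots>, NOut - 1\<close>. In the domains of the wiring functions, \<open>Inl (b, i)\<close> and \<open>Inl (j, b)\<close> are
  inputs and outputs of the box \<open>b\<close>, and \<open>Inr\<close> marks diagram inputs and outputs. Labels and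
  wiring are only meaningful on the finite sets of boxes and dots; isomorphism ignores them
  elsewhere.
\<close>

record ('o, 'm, 'b, 'd) dot_diagram =
  Boxes :: "'b set"
  Dots :: "'d set"
  NIn :: nat
  NOut :: nat
  BLab :: "'b \<Rightarrow> 'm"
  DLab :: "'d \<Rightarrow> 'o"
  ThIn :: "'b \<times> nat + nat \<Rightarrow> 'd"
  ThOut :: "nat \<times> 'b + nat \<Rightarrow> 'd"

definition box_inputs :: "('o, 'm) signature \<Rightarrow> ('o, 'm, 'b, 'd) dot_diagram \<Rightarrow> ('b \<times> nat) set" where
  "box_inputs \<Sigma> F = {(b, i). b \<in> Boxes F \<and> i < length (SDom \<Sigma> (BLab F b))}"

definition box_outputs :: "('o, 'm) signature \<Rightarrow> ('o, 'm, 'b, 'd) dot_diagram \<Rightarrow> (nat \<times> 'b) set" where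
  "box_outputs \<Sigma> F = {(j, b). b \<in> Boxes F \<and> j < length (SCod \<Sigma> (BLab F b))}"

definition is_dot_diagram :: "('o, 'm) signature \<Rightarrow> ('o, 'm, 'b, 'd) dot_diagram \<Rightarrow> bool" where
  "is_dot_diagram \<Sigma> F \<longleftrightarrow>
     finite (Boxes F) \<and> finite (Dots F) \<and>
     BLab F \<in> Boxes F \<rightarrow> SMor \<Sigma> \<and> DLab F \<in> Dots F \<rightarrow> SObj \<Sigma> \<and>
     ThIn F \<in> (box_inputs \<Sigma> F <+> {..<NIn F}) \<rightarrow> Dots F \<and>
     ThOut F \<in> (box_outputs \<Sigma> F <+> {..<NOut F}) \<rightarrow> Dots F \<and>
     (\<forall>(b, i) \<in> box_inputs \<Sigma> F. DLab F (ThIn F (Inl (b, i))) = SDom \<Sigma> (BLab F b) ! i) \<and>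
     (\<forall>(j, b) \<in> box_outputs \<Sigma> F. DLab F (ThOut F (Inl (j, b))) = SCod \<Sigma> (BLab F b) ! j)"

definition dd_homomorphism ::
  "('o, 'm) signature \<Rightarrow> ('o, 'm, 'b, 'd) dot_diagram \<Rightarrow> ('o, 'm, 'b2, 'd2) dot_diagram
    \<Rightarrow> ('b \<Rightarrow> 'b2) \<Rightarrow> ('d \<Rightarrow> 'd2) \<Rightarrow> bool" where
  "dd_homomorphism \<Sigma> F G \<Phi>b \<Phi>d \<longleftrightarrow>
     NIn F = NIn G \<and> NOut F = NOut G \<and>
     \<Phi>b \<in> Boxes F \<rightarrow> Boxes G \<and> \<Phi>d \<in> Dots F \<rightarrow> Dots G \<and>
     (\<forall>b \<in> Boxes F. BLab G (\<Phi>b b) = BLab F b) \<and>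
     (\<forall>d \<in> Dots F. DLab G (\<Phi>d d) = DLab F d) \<and>
     (\<forall>(b, i) \<in> box_inputs \<Sigma> F. ThIn G (Inl (\<Phi>b b, i)) = \<Phi>d (ThIn F (Inl (b, i)))) \<and>
     (\<forall>(j, b) \<in> box_outputs \<Sigma> F. ThOut G (Inl (j, \<Phi>b b)) = \<Phi>d (ThOut F (Inl (j, b)))) \<and>
     (\<forall>i < NIn F. ThIn G (Inr i) = \<Phi>d (ThIn F (Inr i))) \<and>
     (\<forall>j < NOut F. ThOut G (Inr j) = \<Phi>d (ThOut F (Inr j)))"

definition dd_isomorphic ::
  "('o, 'm) signature \<Rightarrow> ('o, 'm, 'b, 'd) dot_diagram \<Rightarrow> ('o, 'm, 'b2, 'd2) dot_diagram \<Rightarrow> bool" where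
  "dd_isomorphic \<Sigma> F G \<longleftrightarrow>
     (\<exists>\<Phi>b \<Phi>d \<Psi>b \<Psi>d. dd_homomorphism \<Sigma> F G \<Phi>b \<Phi>d \<and> dd_homomorphism \<Sigma> G F \<Psi>b \<Psi>d \<and>
       (\<forall>b \<in> Boxes F. \<Psi>b (\<Phi>b b) = b) \<and> (\<forall>b \<in> Boxes G. \<Phi>b (\<Psi>b b) = b) \<and>
       (\<forall>d \<in> Dots F. \<Psi>d (\<Phi>d d) = d) \<and> (\<forall>d \<in> Dots G. \<Phi>d (\<Psi>d d) = d))"

definition has_boundary :: "('o, 'm, 'b, 'd) dot_diagram \<Rightarrow> 'o list \<Rightarrow> 'o list \<Rightarrow> bool" where
  "has_boundary F v w \<longleftrightarrow>
     NIn F = length v \<and> NOut F = length w \<and>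
     (\<forall>i < length v. DLab F (ThIn F (Inr i)) = v ! i) \<and>
     (\<forall>j < length w. DLab F (ThOut F (Inr j)) = w ! j)"

definition glue ::
  "('o, 'm, 'b, 'd) dot_diagram \<Rightarrow> ('o, 'm, 'b2, 'd2) dot_diagram \<Rightarrow> (('d + 'd2) \<times> ('d + 'd2)) set" where
  "glue F G = {(Inl (ThOut F (Inr j)), Inr (ThIn G (Inr j))) | j. j < NOut F}"

definition glue_equiv ::
  "('o, 'm, 'b, 'd) dot_diagram \<Rightarrow> ('o, 'm, 'b2, 'd2) dot_diagram \<Rightarrow> (('d + 'd2) \<times> ('d + 'd2)) set" where
  "glue_equiv F G = (glue F G \<union> (glue F G)\<inverse>)\<^sup>*"

text \<open>
  The composite \<open>G \<circ> F\<close>. The pushout of the sets of dots is the quotient of their disjoint union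
  by the equivalence relation generated by \<open>glue F G\<close>. All elements of a class carry the same
  label, which is what \<open>the_elem\<close> extracts.
\<close>

definition dd_comp ::
  "('o, 'm, 'b2, 'd2) dot_diagram \<Rightarrow> ('o, 'm, 'b, 'd) dot_diagram
    \<Rightarrow> ('o, 'm, 'b + 'b2, ('d + 'd2) set) dot_diagram" where
  "dd_comp G F =
    (let q = (\<lambda>x. glue_equiv F G `` {x}) in
     \<lparr> Boxes = Boxes F <+> Boxes G,
       Dots = (Dots F <+> Dots G) // glue_equiv F G,
       NIn = NIn F,
       NOut = NOut G,
       BLab = case_sum (BLab F) (BLab G),
       DLab = (\<lambda>X. the_elem (case_sum (DLab F) (DLab G) ` X)),
       ThIn = (\<lambda>x. case x of
           Inl (Inl b, i) \<Rightarrow> q (Inl (ThIn F (Inl (b, i))))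
         | Inl (Inr b, i) \<Rightarrow> q (Inr (ThIn G (Inl (b, i))))
         | Inr i \<Rightarrow> q (Inl (ThIn F (Inr i)))),
       ThOut = (\<lambda>x. case x of
           Inl (j, Inl b) \<Rightarrow> q (Inl (ThOut F (Inl (j, b))))
         | Inl (j, Inr b) \<Rightarrow> q (Inr (ThOut G (Inl (j, b))))
         | Inr j \<Rightarrow> q (Inr (ThOut G (Inr j)))) \<rparr>)"

definition dd_tensor ::
  "('o, 'm, 'b, 'd) dot_diagram \<Rightarrow> ('o, 'm, 'b2, 'd2) dot_diagram
    \<Rightarrow> ('o, 'm, 'b + 'b2, 'd + 'd2) dot_diagram" where
  "dd_tensor F G =
     \<lparr> Boxes = Boxes F <+> Boxes G,
       Dots = Dots F <+> Dots G,
       NIn = NIn F + NIn G,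
       NOut = NOut F + NOut G,
       BLab = case_sum (BLab F) (BLab G),
       DLab = case_sum (DLab F) (DLab G),
       ThIn = (\<lambda>x. case x of
           Inl (Inl b, i) \<Rightarrow> Inl (ThIn F (Inl (b, i)))
         | Inl (Inr b, i) \<Rightarrow> Inr (ThIn G (Inl (b, i)))
         | Inr i \<Rightarrow> (if i < NIn F then Inl (ThIn F (Inr i)) else Inr (ThIn G (Inr (i - NIn F))))),
       ThOut = (\<lambda>x. case x of
           Inl (j, Inl b) \<Rightarrow> Inl (ThOut F (Inl (j, b)))
         | Inl (j, Inr b) \<Rightarrow> Inr (ThOut G (Inl (j, b)))
         | Inr j \<Rightarrow> (if j < NOut F then Inl (ThOut F (Inr j)) else Inr (ThOut G (Inr (j - NOut F))))) \<rparr>"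

text \<open>
  The box-free diagram with one dot per letter of \<open>w\<close>, \<open>m\<close> inputs and \<open>n\<close> outputs, input \<open>i\<close>
  being connected to dot \<open>f i\<close> and output \<open>j\<close> to dot \<open>g j\<close>.
\<close>

definition box_free ::
  "'o list \<Rightarrow> nat \<Rightarrow> (nat \<Rightarrow> nat) \<Rightarrow> nat \<Rightarrow> (nat \<Rightarrow> nat) \<Rightarrow> ('o, 'm, nat, nat) dot_diagram" where
  "box_free w m f n g =
     \<lparr> Boxes = {}, Dots = {..<length w}, NIn = m, NOut = n,
       BLab = (\<lambda>_. undefined), DLab = (\<lambda>d. w ! d),
       ThIn = case_sum (\<lambda>_. undefined) f,
       ThOut = case_sum (\<lambda>_. undefined) g \<rparr>"


section \<open>The category of dot-diagrams\<close>

text \<open>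
  An isomorphism class is represented by its set of members whose boxes and dots are natural
  numbers; every finite diagram is isomorphic to such a member.
\<close>

type_synonym ('o, 'm) dot_arrow = "('o, 'm, nat, nat) dot_diagram set"

definition dd_class :: "('o, 'm) signature \<Rightarrow> ('o, 'm, 'b, 'd) dot_diagram \<Rightarrow> ('o, 'm) dot_arrow" where
  "dd_class \<Sigma> F = {H. is_dot_diagram \<Sigma> H \<and> dd_isomorphic \<Sigma> F H}"

definition dot_hom :: "('o, 'm) signature \<Rightarrow> 'o list \<Rightarrow> 'o list \<Rightarrow> ('o, 'm) dot_arrow set" where
  "dot_hom \<Sigma> v w =
     {dd_class \<Sigma> F | F :: ('o, 'm, nat, nat) dot_diagram. is_dot_diagram \<Sigma> F \<and> has_boundary F v w}"

definition dot_comp :: "('o, 'm) signature \<Rightarrow> ('o, 'm) dot_arrow \<Rightarrow> ('o, 'm) dot_arrow \<Rightarrow> ('o, 'm) dot_arrow" where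
  "dot_comp \<Sigma> g f = (\<Union>G \<in> g. \<Union>F \<in> f. dd_class \<Sigma> (dd_comp G F))"

definition dot_tensor :: "('o, 'm) signature \<Rightarrow> ('o, 'm) dot_arrow \<Rightarrow> ('o, 'm) dot_arrow \<Rightarrow> ('o, 'm) dot_arrow" where
  "dot_tensor \<Sigma> f g = (\<Union>F \<in> f. \<Union>G \<in> g. dd_class \<Sigma> (dd_tensor F G))"

definition dot_id :: "('o, 'm) signature \<Rightarrow> 'o list \<Rightarrow> ('o, 'm) dot_arrow" where
  "dot_id \<Sigma> w = dd_class \<Sigma> (box_free w (length w) (\<lambda>i. i) (length w) (\<lambda>j. j))"

definition dot_swap :: "('o, 'm) signature \<Rightarrow> 'o list \<Rightarrow> 'o list \<Rightarrow> ('o, 'm) dot_arrow" where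
  "dot_swap \<Sigma> v w = dd_class \<Sigma>
     (box_free (v @ w)
       (length v + length w) (\<lambda>i. i)
       (length v + length w) (\<lambda>j. if j < length w then length v + j else j - length w))"

definition dot_spider :: "('o, 'm) signature \<Rightarrow> 'o \<Rightarrow> nat \<Rightarrow> nat \<Rightarrow> ('o, 'm) dot_arrow" where
  "dot_spider \<Sigma> A m n = dd_class \<Sigma> (box_free [A] m (\<lambda>_. 0) n (\<lambda>_. 0))"

text \<open>
  The Frobenius structure on a word is the product of the one on its first letter and the one
  on the rest; on the empty word, the unit object, it consists of identities.
\<close>

primrec dot_mu :: "('o, 'm) signature \<Rightarrow> 'o list \<Rightarrow> ('o, 'm) dot_arrow" where
  "dot_mu \<Sigma> [] = dot_id \<Sigma> []"
| "dot_mu \<Sigma> (A # w) =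
     dot_comp \<Sigma> (dot_tensor \<Sigma> (dot_spider \<Sigma> A 2 1) (dot_mu \<Sigma> w))
       (dot_tensor \<Sigma> (dot_tensor \<Sigma> (dot_id \<Sigma> [A]) (dot_swap \<Sigma> w [A])) (dot_id \<Sigma> w))"

primrec dot_eta :: "('o, 'm) signature \<Rightarrow> 'o list \<Rightarrow> ('o, 'm) dot_arrow" where
  "dot_eta \<Sigma> [] = dot_id \<Sigma> []"
| "dot_eta \<Sigma> (A # w) = dot_tensor \<Sigma> (dot_spider \<Sigma> A 0 1) (dot_eta \<Sigma> w)"

primrec dot_delta :: "('o, 'm) signature \<Rightarrow> 'o list \<Rightarrow> ('o, 'm) dot_arrow" where
  "dot_delta \<Sigma> [] = dot_id \<Sigma> []"
| "dot_delta \<Sigma> (A # w) =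
     dot_comp \<Sigma> (dot_tensor \<Sigma> (dot_tensor \<Sigma> (dot_id \<Sigma> [A]) (dot_swap \<Sigma> [A] w)) (dot_id \<Sigma> w))
       (dot_tensor \<Sigma> (dot_spider \<Sigma> A 1 2) (dot_delta \<Sigma> w))"

primrec dot_epsilon :: "('o, 'm) signature \<Rightarrow> 'o list \<Rightarrow> ('o, 'm) dot_arrow" where
  "dot_epsilon \<Sigma> [] = dot_id \<Sigma> []"
| "dot_epsilon \<Sigma> (A # w) = dot_tensor \<Sigma> (dot_spider \<Sigma> A 1 0) (dot_epsilon \<Sigma> w)"

definition Dot :: "('o, 'm) signature \<Rightarrow> ('o list, ('o, 'm) dot_arrow) hypergraph_structure" where
  "Dot \<Sigma> =
     \<lparr> Ob = lists (SObj \<Sigma>),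
       Hom = dot_hom \<Sigma>,
       Id = dot_id \<Sigma>,
       Comp = dot_comp \<Sigma>,
       TensorO = (@),
       Tensor = dot_tensor \<Sigma>,
       UnitO = [],
       Assoc = (\<lambda>u v w. dot_id \<Sigma> (u @ v @ w)),
       LUnit = dot_id \<Sigma>,
       RUnit = dot_id \<Sigma>,
       Sym = dot_swap \<Sigma>,
       Mu = dot_mu \<Sigma>,
       Eta = dot_eta \<Sigma>,
       Delta = dot_delta \<Sigma>,
       Epsilon = dot_epsilon \<Sigma> \<rparr>"


section \<open>The category of matrices\<close>

text \<open>
  The finite sets serving as objects have their elements in a type that contains a point and is
  closed under pairing, so that the unit and the products of objects are again objects. Over any
  type of atoms it is infinite, so there are objects of every finite cardinality.
\<close>

datatype 'u elem = Atom 'u | Point | Pr (left: "'u elem") (right: "'u elem")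

definition set_prod :: "'u elem set \<Rightarrow> 'u elem set \<Rightarrow> 'u elem set" where
  "set_prod I J = {Pr i j | i j. i \<in> I \<and> j \<in> J}"

text \<open>Entries outside the index sets are normalised to 0, so that equality is entrywise equality.\<close>

record ('u, 'k) matrix =
  MDom :: "'u elem set"
  MCod :: "'u elem set"
  Entry :: "'u elem \<Rightarrow> 'u elem \<Rightarrow> 'k"

definition mk_matrix ::
  "'u elem set \<Rightarrow> 'u elem set \<Rightarrow> ('u elem \<Rightarrow> 'u elem \<Rightarrow> 'k::zero) \<Rightarrow> ('u, 'k) matrix" where
  "mk_matrix I J e =
     \<lparr> MDom = I, MCod = J, Entry = (\<lambda>i j. if i \<in> I \<and> j \<in> J then e i j else 0) \<rparr>"

text \<open>The 0-1 matrix of a map.\<close>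

definition map_matrix ::
  "'u elem set \<Rightarrow> 'u elem set \<Rightarrow> ('u elem \<Rightarrow> 'u elem) \<Rightarrow> ('u, 'k::zero_neq_one) matrix" where
  "map_matrix I J h = mk_matrix I J (\<lambda>i j. if j = h i then 1 else 0)"

definition mat_comp :: "('u, 'k::semiring_0) matrix \<Rightarrow> ('u, 'k) matrix \<Rightarrow> ('u, 'k) matrix" where
  "mat_comp g f =
     mk_matrix (MDom f) (MCod g) (\<lambda>i k. \<Sum>j \<in> MCod f. Entry f i j * Entry g j k)"

definition mat_tensor :: "('u, 'k::semiring_0) matrix \<Rightarrow> ('u, 'k) matrix \<Rightarrow> ('u, 'k) matrix" where
  "mat_tensor f g =
     mk_matrix (set_prod (MDom f) (MDom g)) (set_prod (MCod f) (MCod g))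
       (\<lambda>x y. Entry f (left x) (left y) * Entry g (right x) (right y))"

definition Mat :: "('u elem set, ('u, 'k::field) matrix) hypergraph_structure" where
  "Mat =
     \<lparr> Ob = {I. finite I},
       Hom = (\<lambda>I J. range (mk_matrix I J)),
       Id = (\<lambda>I. map_matrix I I (\<lambda>i. i)),
       Comp = mat_comp,
       TensorO = set_prod,
       Tensor = mat_tensor,
       UnitO = {Point},
       Assoc = (\<lambda>I J L. map_matrix (set_prod (set_prod I J) L) (set_prod I (set_prod J L))
         (\<lambda>x. Pr (left (left x)) (Pr (right (left x)) (right x)))),
       LUnit = (\<lambda>I. map_matrix (set_prod {Point} I) I right),
       RUnit = (\<lambda>I. map_matrix (set_prod I {Point}) I left),
       Sym = (\<lambda>I J. map_matrix (set_prod I J) (set_prod J I) (\<lambda>x. Pr (right x) (left x))),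
       Mu = (\<lambda>I. mk_matrix (set_prod I I) I (\<lambda>x k. if left x = k \<and> right x = k then 1 else 0)),
       Eta = (\<lambda>I. mk_matrix {Point} I (\<lambda>_ _. 1)),
       Delta = (\<lambda>I. mk_matrix I (set_prod I I) (\<lambda>i y. if i = left y \<and> i = right y then 1 else 0)),
       Epsilon = (\<lambda>I. mk_matrix I {Point} (\<lambda>_ _. 1)) \<rparr>"

end

theory Submission
  imports Defs
begin

text \<open>
  Finite index sets for the letters and arbitrary matrices for the generators determine a
  hypergraph functor: a diagram is sent to the matrix of its state sums, in which the dots are
  summed over. A diagram \<open>H\<close> yields such data, taking as indices of a letter the dots of \<open>H\<close> with
  that label and as entries of a generator the numbers of boxes of \<open>H\<close> with the given wiring. Then
  the entry of \<open>\<lbrakk>F\<rbrakk>\<close> at the boundary of \<open>H\<close> is the number of homomorphisms \<open>F \<rightarrow> H\<close>, which can be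
  read off in characteristic 0. As in Lovasz's theorem, the numbers of homomorphisms
  into all \<open>H\<close> determine \<open>F\<close>: sorting homomorphisms by their image and induction on the size of
  \<open>H\<close> shows that they determine the numbers of surjective homomorphisms, so if \<open>F\<close> and \<open>G\<close> have
  the same numbers there are surjections in both directions between these finite diagrams.
\<close>

section \<open>Dot-diagrams\<close>

text \<open>Only the functors coming from interpretations are needed, one for each test diagram
  \<open>H\<close>. Two obstacles shape their construction. An arrow is an isomorphism class and a
  functor has to pick a representative of it, so facts about arrows are phrased for all
  representatives at once. And concatenation of words is strictly associative while pairing in
  \<open>Mat\<close> is not, so the comparison isomorphisms are genuine rebracketings. Counting into
  all \<open>H\<close> compares \<open>F\<close> with \<open>G\<close> because \<open>F\<close> and
  \<open>G\<close> themselves are among the \<open>H\<close>: the identity makes one of the two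
  surjection counts nonzero, hence also the other. For finite diagrams, surjections both ways force
  bijections, and a bijective homomorphism is invertible because labels and wiring are functions
  rather than relations.\<close>

lemma in_Plus_iff [simp]:
  "Inl a \<in> A <+> B \<longleftrightarrow> a \<in> A" "Inr b \<in> A <+> B \<longleftrightarrow> b \<in> B"
  by auto

lemma is_dot_diagram_iff:
  "is_dot_diagram \<Sigma> F \<longleftrightarrow>
     finite (Boxes F) \<and> finite (Dots F) \<and>
     (\<forall>b \<in> Boxes F. BLab F b \<in> SMor \<Sigma>) \<and> (\<forall>d \<in> Dots F. DLab F d \<in> SObj \<Sigma>) \<and>
     (\<forall>b \<in> Boxes F. \<forall>i < length (SDom \<Sigma> (BLab F b)).
        ThIn F (Inl (b, i)) \<in> Dots F \<and> DLab F (ThIn F (Inl (b, i))) = SDom \<Sigma> (BLab F b) ! i) \<and>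
     (\<forall>b \<in> Boxes F. \<forall>j < length (SCod \<Sigma> (BLab F b)).
        ThOut F (Inl (j, b)) \<in> Dots F \<and> DLab F (ThOut F (Inl (j, b))) = SCod \<Sigma> (BLab F b) ! j) \<and>
     (\<forall>i < NIn F. ThIn F (Inr i) \<in> Dots F) \<and> (\<forall>j < NOut F. ThOut F (Inr j) \<in> Dots F)"
  unfolding is_dot_diagram_def box_inputs_def box_outputs_def Pi_def Plus_def
  by (auto 0 3)

lemma dd_homomorphism_iff:
  "dd_homomorphism \<Sigma> F G \<Phi>b \<Phi>d \<longleftrightarrow>
     NIn F = NIn G \<and> NOut F = NOut G \<and>
     (\<forall>b \<in> Boxes F. \<Phi>b b \<in> Boxes G \<and> BLab G (\<Phi>b b) = BLab F b) \<and>
     (\<forall>d \<in> Dots F. \<Phi>d d \<in> Dots G \<and> DLab G (\<Phi>d d) = DLab F d) \<and>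
     (\<forall>b \<in> Boxes F. \<forall>i < length (SDom \<Sigma> (BLab F b)).
        ThIn G (Inl (\<Phi>b b, i)) = \<Phi>d (ThIn F (Inl (b, i)))) \<and>
     (\<forall>b \<in> Boxes F. \<forall>j < length (SCod \<Sigma> (BLab F b)).
        ThOut G (Inl (j, \<Phi>b b)) = \<Phi>d (ThOut F (Inl (j, b)))) \<and>
     (\<forall>i < NIn F. ThIn G (Inr i) = \<Phi>d (ThIn F (Inr i))) \<and>
     (\<forall>j < NOut F. ThOut G (Inr j) = \<Phi>d (ThOut F (Inr j)))"
  unfolding dd_homomorphism_def box_inputs_def box_outputs_def Pi_def
  by (auto 0 3)

lemma dd_homomorphism_maps:
  assumes "dd_homomorphism \<Sigma> F G \<Phi>b \<Phi>d"
  shows "b \<in> Boxes F \<Longrightarrow> \<Phi>b b \<in> Boxes G" "d \<in> Dots F \<Longrightarrow> \<Phi>d d \<in> Dots G"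
  using assms by (simp_all add: dd_homomorphism_iff)

lemma dd_isomorphic_sym: "dd_isomorphic \<Sigma> F G \<Longrightarrow> dd_isomorphic \<Sigma> G F"
  unfolding dd_isomorphic_def by blast

lemma dd_homomorphism_comp:
  assumes "is_dot_diagram \<Sigma> F" "dd_homomorphism \<Sigma> F G \<Phi>b \<Phi>d" "dd_homomorphism \<Sigma> G H \<Psi>b \<Psi>d"
  shows "dd_homomorphism \<Sigma> F H (\<Psi>b \<circ> \<Phi>b) (\<Psi>d \<circ> \<Phi>d)"
  using assms unfolding dd_homomorphism_iff is_dot_diagram_iff by simp

lemma dd_isomorphic_trans:
  assumes "is_dot_diagram \<Sigma> F" "is_dot_diagram \<Sigma> H" "dd_isomorphic \<Sigma> F G" "dd_isomorphic \<Sigma> G H"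
  shows "dd_isomorphic \<Sigma> F H"
proof -
  obtain p q p' q' where 1: "dd_homomorphism \<Sigma> F G p q" "dd_homomorphism \<Sigma> G F p' q'"
      "\<forall>b \<in> Boxes F. p' (p b) = b" "\<forall>b \<in> Boxes G. p (p' b) = b"
      "\<forall>d \<in> Dots F. q' (q d) = d" "\<forall>d \<in> Dots G. q (q' d) = d"
    using assms(3) unfolding dd_isomorphic_def by blast
  obtain r s r' s' where 2: "dd_homomorphism \<Sigma> G H r s" "dd_homomorphism \<Sigma> H G r' s'"
      "\<forall>b \<in> Boxes G. r' (r b) = b" "\<forall>b \<in> Boxes H. r (r' b) = b"
      "\<forall>d \<in> Dots G. s' (s d) = d" "\<forall>d \<in> Dots H. s (s' d) = d"
    using assms(4) unfolding dd_isomorphic_def by blast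
  have "dd_homomorphism \<Sigma> F H (r \<circ> p) (s \<circ> q)" "dd_homomorphism \<Sigma> H F (p' \<circ> r') (q' \<circ> s')"
    using assms 1 2 by (auto intro: dd_homomorphism_comp)
  moreover have "\<forall>b \<in> Boxes F. (p' \<circ> r') ((r \<circ> p) b) = b" "\<forall>b \<in> Boxes H. (r \<circ> p) ((p' \<circ> r') b) = b"
      "\<forall>d \<in> Dots F. (q' \<circ> s') ((s \<circ> q) d) = d" "\<forall>d \<in> Dots H. (s \<circ> q) ((q' \<circ> s') d) = d"
    using 1(3-6) 2(3-6) dd_homomorphism_maps[OF 1(1)] dd_homomorphism_maps[OF 2(2)] by simp_all
  ultimately show ?thesis unfolding dd_isomorphic_def by blast
qed

text \<open>Every condition on a homomorphism is an equation between values of functions, so it can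
  be read backwards through the inverse maps. For relational structures such as graphs this would
  fail.\<close>

lemma dd_isomorphicI:
  assumes F: "is_dot_diagram \<Sigma> F" and hom: "dd_homomorphism \<Sigma> F G \<Phi>b \<Phi>d"
    and b: "bij_betw \<Phi>b (Boxes F) (Boxes G)" and d: "bij_betw \<Phi>d (Dots F) (Dots G)"
  shows "dd_isomorphic \<Sigma> F G"
proof -
  define \<Psi>b where "\<Psi>b = inv_into (Boxes F) \<Phi>b"
  define \<Psi>d where "\<Psi>d = inv_into (Dots F) \<Phi>d"
  have inv: "\<forall>x \<in> Boxes F. \<Psi>b (\<Phi>b x) = x" "\<forall>x \<in> Boxes G. \<Phi>b (\<Psi>b x) = x \<and> \<Psi>b x \<in> Boxes F"
    "\<forall>x \<in> Dots F. \<Psi>d (\<Phi>d x) = x" "\<forall>x \<in> Dots G. \<Phi>d (\<Psi>d x) = x \<and> \<Psi>d x \<in> Dots F"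
    using b d unfolding \<Psi>b_def \<Psi>d_def
    by (auto simp: bij_betw_def f_inv_into_f inv_into_into)
  have "dd_homomorphism \<Sigma> G F \<Psi>b \<Psi>d"
    unfolding dd_homomorphism_iff
  proof (intro conjI ballI allI impI)
    show "NIn G = NIn F" "NOut G = NOut F" using hom by (auto simp: dd_homomorphism_iff)
  next
    fix x assume x: "x \<in> Boxes G"
    then show "\<Psi>b x \<in> Boxes F" "BLab F (\<Psi>b x) = BLab G x"
      using inv hom by (auto simp: dd_homomorphism_iff) metis
    { fix i assume "i < length (SDom \<Sigma> (BLab G x))"
      then show "ThIn F (Inl (\<Psi>b x, i)) = \<Psi>d (ThIn G (Inl (x, i)))"
        using x inv hom F unfolding dd_homomorphism_iff is_dot_diagram_iff by metis }
    { fix i assume "i < length (SCod \<Sigma> (BLab G x))"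
      then show "ThOut F (Inl (i, \<Psi>b x)) = \<Psi>d (ThOut G (Inl (i, x)))"
        using x inv hom F unfolding dd_homomorphism_iff is_dot_diagram_iff by metis }
  next
    fix x assume "x \<in> Dots G"
    then show "\<Psi>d x \<in> Dots F" "DLab F (\<Psi>d x) = DLab G x"
      using inv hom by (auto simp: dd_homomorphism_iff) metis
  next
    fix i assume "i < NIn G"
    then show "ThIn F (Inr i) = \<Psi>d (ThIn G (Inr i))"
      using inv hom F unfolding dd_homomorphism_iff is_dot_diagram_iff by metis
  next
    fix i assume "i < NOut G"
    then show "ThOut F (Inr i) = \<Psi>d (ThOut G (Inr i))"
      using inv hom F unfolding dd_homomorphism_iff is_dot_diagram_iff by metis
  qed
  then show ?thesis using hom inv unfolding dd_isomorphic_def by blast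
qed

lemma dd_isomorphicE:
  assumes "dd_isomorphic \<Sigma> F G"
  obtains \<Phi>b \<Phi>d where "dd_homomorphism \<Sigma> F G \<Phi>b \<Phi>d"
    "bij_betw \<Phi>b (Boxes F) (Boxes G)" "bij_betw \<Phi>d (Dots F) (Dots G)"
proof -
  obtain p q p' q' where 1: "dd_homomorphism \<Sigma> F G p q" "dd_homomorphism \<Sigma> G F p' q'"
      "\<forall>b \<in> Boxes F. p' (p b) = b" "\<forall>b \<in> Boxes G. p (p' b) = b"
      "\<forall>d \<in> Dots F. q' (q d) = d" "\<forall>d \<in> Dots G. q (q' d) = d"
    using assms unfolding dd_isomorphic_def by blast
  have "bij_betw p (Boxes F) (Boxes G)" "bij_betw q (Dots F) (Dots G)"
    using 1(3-6) dd_homomorphism_maps[OF 1(1)] dd_homomorphism_maps[OF 1(2)]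
    by (auto intro!: bij_betw_byWitness[where f' = p'] bij_betw_byWitness[where f' = q'])
  with 1 that show thesis by blast
qed

text \<open>The boundary dots of \<open>G\<close> are the images of those of \<open>F\<close>, and
  images keep their labels; a homomorphism in one direction therefore gives both
  implications.\<close>

lemma has_boundary_homomorphism:
  assumes "is_dot_diagram \<Sigma> F" "dd_homomorphism \<Sigma> F G \<Phi>b \<Phi>d"
  shows "has_boundary G v w \<longleftrightarrow> has_boundary F v w"
proof -
  have "NIn G = NIn F" "NOut G = NOut F"
    using assms by (auto simp: dd_homomorphism_iff)
  moreover have "\<forall>i < NIn F. DLab G (ThIn G (Inr i)) = DLab F (ThIn F (Inr i))"
    "\<forall>j < NOut F. DLab G (ThOut G (Inr j)) = DLab F (ThOut F (Inr j))"
    using assms by (simp_all add: dd_homomorphism_iff is_dot_diagram_iff)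
  ultimately show ?thesis unfolding has_boundary_def by auto
qed

lemma dd_class_eqI:
  fixes F :: "('o, 'm, 'b, 'd) dot_diagram" and G :: "('o, 'm, 'b2, 'd2) dot_diagram"
  assumes "is_dot_diagram \<Sigma> F" "is_dot_diagram \<Sigma> G" "dd_isomorphic \<Sigma> F G"
  shows "dd_class \<Sigma> F = dd_class \<Sigma> G"
proof -
  have "dd_isomorphic \<Sigma> F H \<longleftrightarrow> dd_isomorphic \<Sigma> G H" if "is_dot_diagram \<Sigma> H"
    for H :: "('o, 'm, nat, nat) dot_diagram"
    using dd_isomorphic_trans[OF assms(1) that assms(3)]
      dd_isomorphic_trans[OF assms(2) that dd_isomorphic_sym[OF assms(3)]] by blast
  then show ?thesis unfolding dd_class_def by blast
qed

text \<open>A class collects only diagrams over the natural numbers, while composites and disjoint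
  unions live over sums and sets. Copying a finite diagram along injections into the naturals shows
  that such an arrow still has a representative to choose.\<close>

lemma dd_class_nonempty:
  fixes F :: "('o, 'm, 'b, 'd) dot_diagram"
  assumes F: "is_dot_diagram \<Sigma> F"
  shows "dd_class \<Sigma> F \<noteq> {}"
proof -
  obtain f :: "'b \<Rightarrow> nat" where f: "inj_on f (Boxes F)"
    using finite_imp_inj_to_nat_seg[of "Boxes F"] F by (auto simp: is_dot_diagram_iff)
  obtain g :: "'d \<Rightarrow> nat" where g: "inj_on g (Dots F)"
    using finite_imp_inj_to_nat_seg[of "Dots F"] F by (auto simp: is_dot_diagram_iff)
  define f' where "f' = inv_into (Boxes F) f"
  have f': "\<And>b. b \<in> Boxes F \<Longrightarrow> f' (f b) = b"
    using f by (simp add: f'_def)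
  define H :: "('o, 'm, nat, nat) dot_diagram" where
    "H = \<lparr> Boxes = f ` Boxes F, Dots = g ` Dots F, NIn = NIn F, NOut = NOut F,
       BLab = BLab F \<circ> f', DLab = DLab F \<circ> inv_into (Dots F) g,
       ThIn = (\<lambda>x. g (ThIn F (case x of Inl (b, i) \<Rightarrow> Inl (f' b, i) | Inr i \<Rightarrow> Inr i))),
       ThOut = (\<lambda>x. g (ThOut F (case x of Inl (j, b) \<Rightarrow> Inl (j, f' b) | Inr j \<Rightarrow> Inr j))) \<rparr>"
  have "is_dot_diagram \<Sigma> H"
    using F g by (simp add: is_dot_diagram_iff H_def f')
  moreover have "dd_homomorphism \<Sigma> F H f g"
    using F g by (simp add: dd_homomorphism_iff is_dot_diagram_iff H_def f')
  then have "dd_isomorphic \<Sigma> F H"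
    by (rule dd_isomorphicI[OF F]) (use f g in \<open>simp_all add: H_def bij_betw_def\<close>)
  ultimately show ?thesis unfolding dd_class_def by blast
qed

section \<open>Disjoint unions of diagrams\<close>

lemma dd_tensor_simps [simp]:
  "Boxes (dd_tensor F G) = Boxes F <+> Boxes G"
  "Dots (dd_tensor F G) = Dots F <+> Dots G"
  "NIn (dd_tensor F G) = NIn F + NIn G"
  "NOut (dd_tensor F G) = NOut F + NOut G"
  "BLab (dd_tensor F G) = case_sum (BLab F) (BLab G)"
  "DLab (dd_tensor F G) = case_sum (DLab F) (DLab G)"
  "ThIn (dd_tensor F G) (Inl (Inl b, i)) = Inl (ThIn F (Inl (b, i)))"
  "ThIn (dd_tensor F G) (Inl (Inr b', i)) = Inr (ThIn G (Inl (b', i)))"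
  "ThIn (dd_tensor F G) (Inr i) =
     (if i < NIn F then Inl (ThIn F (Inr i)) else Inr (ThIn G (Inr (i - NIn F))))"
  "ThOut (dd_tensor F G) (Inl (i, Inl b)) = Inl (ThOut F (Inl (i, b)))"
  "ThOut (dd_tensor F G) (Inl (i, Inr b')) = Inr (ThOut G (Inl (i, b')))"
  "ThOut (dd_tensor F G) (Inr i) =
     (if i < NOut F then Inl (ThOut F (Inr i)) else Inr (ThOut G (Inr (i - NOut F))))"
  by (simp_all add: dd_tensor_def)

lemma is_dot_diagram_tensor:
  assumes "is_dot_diagram \<Sigma> F" "is_dot_diagram \<Sigma> G"
  shows "is_dot_diagram \<Sigma> (dd_tensor F G)"
  using assms unfolding is_dot_diagram_iff by (auto 0 3)

lemma has_boundary_tensor: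
  assumes "has_boundary F v w" "has_boundary G v' w'"
  shows "has_boundary (dd_tensor F G) (v @ v') (w @ w')"
  using assms unfolding has_boundary_def by (auto simp: nth_append)

section \<open>Composites and the pushout of dots\<close>

abbreviation glue_class ::
  "('o, 'm, 'b, 'd) dot_diagram \<Rightarrow> ('o, 'm, 'b2, 'd2) dot_diagram \<Rightarrow> 'd + 'd2 \<Rightarrow> ('d + 'd2) set" where
  "glue_class F G x \<equiv> glue_equiv F G `` {x}"

lemma dd_comp_simps [simp]:
  "Boxes (dd_comp G F) = Boxes F <+> Boxes G"
  "Dots (dd_comp G F) = (Dots F <+> Dots G) // glue_equiv F G"
  "NIn (dd_comp G F) = NIn F"
  "NOut (dd_comp G F) = NOut G"
  "BLab (dd_comp G F) = case_sum (BLab F) (BLab G)"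
  "ThIn (dd_comp G F) (Inl (Inl b, i)) = glue_class F G (Inl (ThIn F (Inl (b, i))))"
  "ThIn (dd_comp G F) (Inl (Inr b', i)) = glue_class F G (Inr (ThIn G (Inl (b', i))))"
  "ThIn (dd_comp G F) (Inr i) = glue_class F G (Inl (ThIn F (Inr i)))"
  "ThOut (dd_comp G F) (Inl (i, Inl b)) = glue_class F G (Inl (ThOut F (Inl (i, b))))"
  "ThOut (dd_comp G F) (Inl (i, Inr b')) = glue_class F G (Inr (ThOut G (Inl (i, b'))))"
  "ThOut (dd_comp G F) (Inr i) = glue_class F G (Inr (ThOut G (Inr i)))"
  by (simp_all add: dd_comp_def)

text \<open>A chain of gluing steps, in either direction, never changes the value. This is the
  universal property of the pushout; it serves the labels of a composite and later its index
  assignments.\<close>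

lemma glue_equiv_constant:
  assumes "\<And>j. j < NOut F \<Longrightarrow> a (ThOut F (Inr j)) = b (ThIn G (Inr j))"
    and "(x, y) \<in> glue_equiv F G"
  shows "case_sum a b x = case_sum a b y"
  using assms(2) unfolding glue_equiv_def
  by (induction rule: rtrancl_induct) (auto simp: glue_def assms(1))

lemma the_elem_glue_class:
  assumes "\<And>j. j < NOut F \<Longrightarrow> a (ThOut F (Inr j)) = b (ThIn G (Inr j))"
  shows "the_elem (case_sum a b ` glue_class F G x) = case_sum a b x"
proof -
  have "x \<in> glue_class F G x" by (simp add: glue_equiv_def)
  moreover have "case_sum a b y = case_sum a b x" if "y \<in> glue_class F G x" for y
    using glue_equiv_constant[of F a b G x y] assms that by simp
  ultimately have "case_sum a b ` glue_class F G x = {case_sum a b x}"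
    by blast
  then show ?thesis by simp
qed

lemma glue_class_eq:
  assumes "j < NOut F"
  shows "glue_class F G (Inl (ThOut F (Inr j))) = glue_class F G (Inr (ThIn G (Inr j)))"
proof -
  let ?R = "glue F G \<union> (glue F G)\<inverse>"
  have "sym (?R\<^sup>*)" "trans (?R\<^sup>*)"
    by (simp_all add: sym_Un_converse sym_rtrancl trans_rtrancl)
  moreover have "(Inl (ThOut F (Inr j)), Inr (ThIn G (Inr j))) \<in> ?R\<^sup>*"
    using assms by (auto simp: glue_def)
  ultimately show ?thesis
    unfolding glue_equiv_def by (auto dest: symD transD)
qed

lemma glue_class_in_Dots:
  "d \<in> Dots F \<Longrightarrow> glue_class F G (Inl d) \<in> (Dots F <+> Dots G) // glue_equiv F G"
  "d' \<in> Dots G \<Longrightarrow> glue_class F G (Inr d') \<in> (Dots F <+> Dots G) // glue_equiv F G"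
  by (auto intro: quotientI)

lemma has_boundary_glue:
  assumes "has_boundary F v w" "has_boundary G w u" "j < NOut F"
  shows "DLab F (ThOut F (Inr j)) = DLab G (ThIn G (Inr j))"
  using assms unfolding has_boundary_def by simp

lemma DLab_dd_comp:
  assumes "has_boundary F v w" "has_boundary G w u"
  shows "DLab (dd_comp G F) (glue_class F G x) = case_sum (DLab F) (DLab G) x"
  using has_boundary_glue[OF assms] by (simp add: dd_comp_def Let_def the_elem_glue_class)

lemma is_dot_diagram_comp:
  assumes "is_dot_diagram \<Sigma> F" "is_dot_diagram \<Sigma> G" "has_boundary F v w" "has_boundary G w u"
  shows "is_dot_diagram \<Sigma> (dd_comp G F)"
proof -
  have "DLab (dd_comp G F) d \<in> SObj \<Sigma>" if d: "d \<in> Dots (dd_comp G F)" for d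
  proof -
    obtain x where x: "x \<in> Dots F <+> Dots G" "d = glue_class F G x"
      using d unfolding dd_comp_simps by (rule quotientE)
    show ?thesis
      unfolding x(2) DLab_dd_comp[OF assms(3,4)]
      using x(1) assms(1,2) by (auto simp: is_dot_diagram_iff)
  qed
  moreover have "finite (Dots (dd_comp G F))"
    using assms by (simp add: quotient_def is_dot_diagram_iff)
  ultimately show ?thesis using assms(1,2)
    unfolding is_dot_diagram_iff
    by (auto simp: DLab_dd_comp[OF assms(3,4)] glue_class_in_Dots)
qed

lemma has_boundary_comp:
  assumes "has_boundary F v w" "has_boundary G w u"
  shows "has_boundary (dd_comp G F) v u"
  using assms unfolding has_boundary_def by (simp add: DLab_dd_comp[OF assms])

section \<open>Box-free diagrams\<close>

lemma box_free_simps [simp]: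
  "Boxes (box_free w m f n g) = {}"
  "Dots (box_free w m f n g) = {..<length w}"
  "NIn (box_free w m f n g) = m"
  "NOut (box_free w m f n g) = n"
  "DLab (box_free w m f n g) d = w ! d"
  "ThIn (box_free w m f n g) (Inr i) = f i"
  "ThOut (box_free w m f n g) (Inr j) = g j"
  by (simp_all add: box_free_def)

lemma is_dot_diagram_box_free:
  assumes "w \<in> lists (SObj \<Sigma>)" "\<And>i. i < m \<Longrightarrow> f i < length w" "\<And>j. j < n \<Longrightarrow> g j < length w"
  shows "is_dot_diagram \<Sigma> (box_free w m f n g)"
  using assms unfolding is_dot_diagram_iff by (auto simp: in_lists_conv_set)

section \<open>State sums\<close>

definition tuples :: "('o \<Rightarrow> 'x set) \<Rightarrow> 'o list \<Rightarrow> 'x list set" where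
  "tuples X w = {xs. list_all2 (\<lambda>x A. x \<in> X A) xs w}"

lemma tuples_iff_nth:
  "xs \<in> tuples X w \<longleftrightarrow> length xs = length w \<and> (\<forall>i < length w. xs ! i \<in> X (w ! i))"
  by (auto simp: tuples_def list_all2_conv_all_nth)

lemma tuples_Nil [simp]: "tuples X [] = {[]}"
  by (auto simp: tuples_def)

lemma tuples_Cons: "tuples X (A # w) = (\<lambda>(x, xs). x # xs) ` (X A \<times> tuples X w)"
  by (auto simp: tuples_def list_all2_Cons2)

lemma Cons_in_tuples [simp]: "x # xs \<in> tuples X (A # w) \<longleftrightarrow> x \<in> X A \<and> xs \<in> tuples X w"
  by (auto simp: tuples_def)

lemma length_tuples: "xs \<in> tuples X w \<Longrightarrow> length xs = length w"
  by (simp add: tuples_iff_nth)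

lemma append_in_tuples:
  "xs \<in> tuples X v \<Longrightarrow> ys \<in> tuples X w \<Longrightarrow> xs @ ys \<in> tuples X (v @ w)"
  by (simp add: tuples_def list_all2_appendI)

lemma take_in_tuples: "xs \<in> tuples X (v @ w) \<Longrightarrow> take (length v) xs \<in> tuples X v"
  by (auto simp: tuples_def list_all2_append2)

lemma drop_in_tuples: "xs \<in> tuples X (v @ w) \<Longrightarrow> drop (length v) xs \<in> tuples X w"
  by (auto simp: tuples_def list_all2_append2)

lemma finite_tuples:
  assumes "\<And>A. finite (X A)"
  shows "finite (tuples X w)"
  by (induction w) (simp_all add: tuples_Cons assms)

text \<open>
  The letter \<open>A\<close> is interpreted by the index set \<open>X A\<close>, the generator \<open>f\<close> by the matrix \<open>T f\<close>.
\<close>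

locale interpretation_data =
  fixes \<Sigma> :: "('o, 'm) signature"
    and X :: "'o \<Rightarrow> 'x set"
    and T :: "'m \<Rightarrow> 'x list \<Rightarrow> 'x list \<Rightarrow> 'k::comm_semiring_1"
  assumes finite_X: "finite (X A)"
begin

lemmas finite_tup = finite_tuples[of X, OF finite_X]

text \<open>\<open>PiE\<close> fixes the values outside the dots, so each assignment is counted
  once. Boundary positions wired to one dot force equal indices, which is how the Kronecker deltas
  of the Frobenius structure arise.\<close>

definition states ::
  "('o, 'm, 'b, 'd) dot_diagram \<Rightarrow> 'x list \<Rightarrow> 'x list \<Rightarrow> ('d \<Rightarrow> 'x) set" where
  "states F xs ys = {l \<in> PiE (Dots F) (\<lambda>d. X (DLab F d)).
     (\<forall>i < NIn F. l (ThIn F (Inr i)) = xs ! i) \<and> (\<forall>j < NOut F. l (ThOut F (Inr j)) = ys ! j)}"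

definition weight :: "('o, 'm, 'b, 'd) dot_diagram \<Rightarrow> ('d \<Rightarrow> 'x) \<Rightarrow> 'k" where
  "weight F l = (\<Prod>b \<in> Boxes F. T (BLab F b)
     (map (\<lambda>i. l (ThIn F (Inl (b, i)))) [0..<length (SDom \<Sigma> (BLab F b))])
     (map (\<lambda>j. l (ThOut F (Inl (j, b)))) [0..<length (SCod \<Sigma> (BLab F b))]))"

text \<open>The contraction of a tensor network, with one tensor per box and one summation index per
  dot away from the boundary.\<close>

definition state_sum :: "('o, 'm, 'b, 'd) dot_diagram \<Rightarrow> 'x list \<Rightarrow> 'x list \<Rightarrow> 'k" where
  "state_sum F xs ys = (\<Sum>l \<in> states F xs ys. weight F l)"

lemma states_iff:
  "l \<in> states F xs ys \<longleftrightarrow> l \<in> extensional (Dots F) \<and> (\<forall>d \<in> Dots F. l d \<in> X (DLab F d)) \<and>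
     (\<forall>i < NIn F. l (ThIn F (Inr i)) = xs ! i) \<and> (\<forall>j < NOut F. l (ThOut F (Inr j)) = ys ! j)"
  by (auto simp: states_def PiE_iff)

lemma states_restrict: "l \<in> states F xs ys \<Longrightarrow> restrict l (Dots F) = l"
  by (simp add: states_iff extensional_restrict)

lemma finite_states:
  assumes "is_dot_diagram \<Sigma> F"
  shows "finite (states F xs ys)"
proof -
  have "finite (PiE (Dots F) (\<lambda>d. X (DLab F d)))"
    using assms by (intro finite_PiE) (auto simp: is_dot_diagram_iff finite_X)
  then show ?thesis unfolding states_def by (rule rev_finite_subset) auto
qed

lemma weight_cong:
  assumes "is_dot_diagram \<Sigma> F" "\<And>d. d \<in> Dots F \<Longrightarrow> l d = l' d"
  shows "weight F l = weight F l'"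
  unfolding weight_def
proof (rule prod.cong[OF refl], goal_cases)
  case (1 b)
  then have "map (\<lambda>i. l (ThIn F (Inl (b, i)))) [0..<length (SDom \<Sigma> (BLab F b))] =
      map (\<lambda>i. l' (ThIn F (Inl (b, i)))) [0..<length (SDom \<Sigma> (BLab F b))]"
    and "map (\<lambda>j. l (ThOut F (Inl (j, b)))) [0..<length (SCod \<Sigma> (BLab F b))] =
      map (\<lambda>j. l' (ThOut F (Inl (j, b)))) [0..<length (SCod \<Sigma> (BLab F b))]"
    using assms by (auto simp: is_dot_diagram_iff)
  then show ?case by (simp only:)
qed

lemma weight_restrict [simp]:
  "is_dot_diagram \<Sigma> F \<Longrightarrow> weight F (restrict l (Dots F)) = weight F l"
  by (rule weight_cong) auto

text \<open>The homomorphism carries the wiring along, so each box of \<open>F\<close> sees the same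
  indices as its image; bijectivity on boxes matches the factors of the two products.\<close>

lemma weight_homomorphism:
  assumes F: "is_dot_diagram \<Sigma> F" and hom: "dd_homomorphism \<Sigma> F G \<Phi>b \<Phi>d"
    and b: "bij_betw \<Phi>b (Boxes F) (Boxes G)"
  shows "weight F (l \<circ> \<Phi>d) = weight G l"
  unfolding weight_def
proof (subst prod.reindex_bij_betw[OF b, symmetric])
  show "(\<Prod>b\<in>Boxes F. T (BLab F b)
         (map (\<lambda>i. (l \<circ> \<Phi>d) (ThIn F (Inl (b, i)))) [0..<length (SDom \<Sigma> (BLab F b))])
         (map (\<lambda>j. (l \<circ> \<Phi>d) (ThOut F (Inl (j, b)))) [0..<length (SCod \<Sigma> (BLab F b))])) =
    (\<Prod>b\<in>Boxes F. T (BLab G (\<Phi>b b))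
         (map (\<lambda>i. l (ThIn G (Inl (\<Phi>b b, i)))) [0..<length (SDom \<Sigma> (BLab G (\<Phi>b b)))])
         (map (\<lambda>j. l (ThOut G (Inl (j, \<Phi>b b)))) [0..<length (SCod \<Sigma> (BLab G (\<Phi>b b)))]))"
  proof (rule prod.cong[OF refl], goal_cases)
    case (1 b)
    then have "BLab G (\<Phi>b b) = BLab F b"
      and "map (\<lambda>i. l (ThIn G (Inl (\<Phi>b b, i)))) [0..<length (SDom \<Sigma> (BLab F b))] =
        map (\<lambda>i. (l \<circ> \<Phi>d) (ThIn F (Inl (b, i)))) [0..<length (SDom \<Sigma> (BLab F b))]"
      and "map (\<lambda>j. l (ThOut G (Inl (j, \<Phi>b b)))) [0..<length (SCod \<Sigma> (BLab F b))] =
        map (\<lambda>j. (l \<circ> \<Phi>d) (ThOut F (Inl (j, b)))) [0..<length (SCod \<Sigma> (BLab F b))]"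
      using hom by (auto simp: dd_homomorphism_iff)
    then show ?case by (simp only:)
  qed
qed

text \<open>Assignments are transported along the bijection of dots in both directions. This is what
  makes the matrix of an arrow independent of the representative.\<close>

lemma state_sum_isomorphic:
  assumes F: "is_dot_diagram \<Sigma> F" and G: "is_dot_diagram \<Sigma> G" and iso: "dd_isomorphic \<Sigma> F G"
  shows "state_sum F xs ys = state_sum G xs ys"
proof -
  obtain p q where hom: "dd_homomorphism \<Sigma> F G p q"
    and p: "bij_betw p (Boxes F) (Boxes G)" and q: "bij_betw q (Dots F) (Dots G)"
    by (rule dd_isomorphicE[OF iso])
  define q' where "q' = inv_into (Dots F) q"
  have q': "\<And>d. d \<in> Dots F \<Longrightarrow> q' (q d) = d" "\<And>d. d \<in> Dots G \<Longrightarrow> q (q' d) = d"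
      "\<And>d. d \<in> Dots G \<Longrightarrow> q' d \<in> Dots F" "\<And>d. d \<in> Dots F \<Longrightarrow> q d \<in> Dots G"
    using q unfolding q'_def by (auto simp: bij_betw_def f_inv_into_f inv_into_into)
  have lab: "\<And>d. d \<in> Dots F \<Longrightarrow> DLab G (q d) = DLab F d"
    using hom by (simp add: dd_homomorphism_iff)
  then have lab': "\<And>d. d \<in> Dots G \<Longrightarrow> DLab F (q' d) = DLab G d"
    using q' by metis
  have bd: "NIn F = NIn G" "NOut F = NOut G"
    "\<And>i. i < NIn G \<Longrightarrow> ThIn G (Inr i) = q (ThIn F (Inr i))"
    "\<And>i. i < NOut G \<Longrightarrow> ThOut G (Inr i) = q (ThOut F (Inr i))"
    using hom by (simp_all add: dd_homomorphism_iff)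
  have wire: "\<And>i. i < NIn G \<Longrightarrow> ThIn F (Inr i) \<in> Dots F" "\<And>j. j < NOut G \<Longrightarrow> ThOut F (Inr j) \<in> Dots F"
    using F bd by (simp_all add: is_dot_diagram_iff)
  show ?thesis
    unfolding state_sum_def
  proof (rule sum.reindex_bij_witness[where i = "\<lambda>l. restrict (l \<circ> q) (Dots F)"
        and j = "\<lambda>l. restrict (l \<circ> q') (Dots G)"], goal_cases)
    case (1 l)
    have "restrict (restrict (l \<circ> q') (Dots G) \<circ> q) (Dots F) = restrict l (Dots F)"
      by (rule restrict_ext) (simp add: q')
    then show ?case using 1 by (simp add: states_restrict)
  next
    case (2 l)
    then have "l (q' d) \<in> X (DLab G d)" if "d \<in> Dots G" for d
      using lab'[OF that] q'(3)[OF that] unfolding states_iff by metis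
    then show ?case using 2 by (simp add: states_iff bd wire q')
  next
    case (3 l)
    have "restrict (restrict (l \<circ> q) (Dots F) \<circ> q') (Dots G) = restrict l (Dots G)"
      by (rule restrict_ext) (simp add: q')
    then show ?case using 3 by (simp add: states_restrict)
  next
    case (4 l)
    then have "l (q d) \<in> X (DLab F d)" if "d \<in> Dots F" for d
      using lab[OF that] q'(4)[OF that] unfolding states_iff by metis
    then show ?case using 4 by (simp add: states_iff bd wire q')
  next
    case (5 l)
    have "weight F (restrict (l \<circ> q') (Dots G) \<circ> q) = weight F l"
      using F by (rule weight_cong) (simp add: q')
    then show ?case using weight_homomorphism[OF F hom p] by simp
  qed
qed

section \<open>State sums of disjoint unions and composites\<close>

lemma states_tensor:
  assumes F: "is_dot_diagram \<Sigma> F" and G: "is_dot_diagram \<Sigma> G"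
    and "l \<in> states (dd_tensor F G) xs ys"
    and "NIn F \<le> length xs" "NOut F \<le> length ys"
  shows "restrict (l \<circ> Inl) (Dots F) \<in> states F (take (NIn F) xs) (take (NOut F) ys)"
    and "restrict (l \<circ> Inr) (Dots G) \<in> states G (drop (NIn F) xs) (drop (NOut F) ys)"
proof -
  have "\<And>x. x \<in> Dots F <+> Dots G \<Longrightarrow> l x \<in> X (case_sum (DLab F) (DLab G) x)"
    using assms(3) by (simp add: states_iff)
  from this[OF InlI] this[OF InrI]
  have l: "\<And>d. d \<in> Dots F \<Longrightarrow> l (Inl d) \<in> X (DLab F d)" "\<And>d. d \<in> Dots G \<Longrightarrow> l (Inr d) \<in> X (DLab G d)"
    by simp_all
  have bd: "l (ThIn (dd_tensor F G) (Inr i)) = xs ! i" if "i < NIn F + NIn G" for i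
    using assms(3) that unfolding states_iff dd_tensor_simps by blast
  have bd': "l (ThOut (dd_tensor F G) (Inr i)) = ys ! i" if "i < NOut F + NOut G" for i
    using assms(3) that unfolding states_iff dd_tensor_simps by blast
  have "l (Inl (ThIn F (Inr i))) = xs ! i" if "i < NIn F" for i
    using bd[of i] that by simp
  moreover have "l (Inl (ThOut F (Inr i))) = ys ! i" if "i < NOut F" for i
    using bd'[of i] that by simp
  ultimately show "restrict (l \<circ> Inl) (Dots F) \<in> states F (take (NIn F) xs) (take (NOut F) ys)"
    using F l by (simp add: states_iff is_dot_diagram_iff)
  have "l (Inr (ThIn G (Inr i))) = xs ! (NIn F + i)" if "i < NIn G" for i
    using bd[of "NIn F + i"] that by simp
  moreover have "l (Inr (ThOut G (Inr i))) = ys ! (NOut F + i)" if "i < NOut G" for i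
    using bd'[of "NOut F + i"] that by simp
  ultimately show "restrict (l \<circ> Inr) (Dots G) \<in> states G (drop (NIn F) xs) (drop (NOut F) ys)"
    using G l assms(4,5) by (simp add: states_iff is_dot_diagram_iff)
qed

lemma states_tensorI:
  assumes F: "is_dot_diagram \<Sigma> F" and G: "is_dot_diagram \<Sigma> G"
    and l: "l \<in> states F (take (NIn F) xs) (take (NOut F) ys)"
    and k: "k \<in> states G (drop (NIn F) xs) (drop (NOut F) ys)"
    and "NIn F \<le> length xs" "NOut F \<le> length ys"
  shows "restrict (case_sum l k) (Dots F <+> Dots G) \<in> states (dd_tensor F G) xs ys"
  using assms by (auto simp: states_iff is_dot_diagram_iff)

lemma weight_tensor:
  assumes "is_dot_diagram \<Sigma> F" "is_dot_diagram \<Sigma> G"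
  shows "weight (dd_tensor F G) l = weight F (l \<circ> Inl) * weight G (l \<circ> Inr)"
  using assms unfolding weight_def by (simp add: prod.Plus is_dot_diagram_iff)

text \<open>A state of a disjoint union is an independent pair of states and its weight factorises,
  so the sum over pairs is a product of sums. The length bounds make the positions of the dropped
  words line up with the shifted boundary of \<open>G\<close>.\<close>

lemma state_sum_tensor:
  assumes F: "is_dot_diagram \<Sigma> F" and G: "is_dot_diagram \<Sigma> G"
    and len: "NIn F \<le> length xs" "NOut F \<le> length ys"
  shows "state_sum (dd_tensor F G) xs ys =
    state_sum F (take (NIn F) xs) (take (NOut F) ys) * state_sum G (drop (NIn F) xs) (drop (NOut F) ys)"
    (is "?lhs = ?rhs")
proof -
  let ?S = "states F (take (NIn F) xs) (take (NOut F) ys)"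
  let ?S' = "states G (drop (NIn F) xs) (drop (NOut F) ys)"
  have "?rhs = (\<Sum>(l, k) \<in> ?S \<times> ?S'. weight F l * weight G k)"
    by (simp add: state_sum_def sum_product sum.cartesian_product)
  also have "\<dots> = ?lhs"
    unfolding state_sum_def
  proof (rule sum.reindex_bij_witness[where
        j = "\<lambda>(l, k). restrict (case_sum l k) (Dots F <+> Dots G)" and
        i = "\<lambda>l. (restrict (l \<circ> Inl) (Dots F), restrict (l \<circ> Inr) (Dots G))"], goal_cases)
    case (1 a)
    obtain l k where a: "a = (l, k)" by (cases a)
    have "restrict (restrict (case_sum l k) (Dots F <+> Dots G) \<circ> Inl) (Dots F) = restrict l (Dots F)"
      "restrict (restrict (case_sum l k) (Dots F <+> Dots G) \<circ> Inr) (Dots G) = restrict k (Dots G)"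
      by (rule restrict_ext, simp)+
    moreover have "restrict l (Dots F) = l" "restrict k (Dots G) = k"
      using 1 states_restrict by (auto simp: a)
    ultimately show ?case by (simp add: a)
  next
    case (2 a)
    then show ?case using states_tensorI[OF F G _ _ len] by auto
  next
    case (3 l)
    have "restrict (case_sum (restrict (l \<circ> Inl) (Dots F)) (restrict (l \<circ> Inr) (Dots G))) (Dots F <+> Dots G)
        = restrict l (Dots F <+> Dots G)"
      by (rule restrict_ext) auto
    then show ?case using states_restrict[OF 3] by simp
  next
    case (4 l)
    then show ?case using states_tensor[OF F G _ len] by auto
  next
    case (5 a)
    have "weight F (restrict (case_sum l k) (Dots F <+> Dots G) \<circ> Inl) = weight F l"
      "weight G (restrict (case_sum l k) (Dots F <+> Dots G) \<circ> Inr) = weight G k" for l k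
      by (rule weight_cong[OF F], simp) (rule weight_cong[OF G], simp)
    then show ?case by (auto simp: weight_tensor[OF F G] split_beta)
  qed
  finally show ?thesis by simp
qed

lemma weight_comp:
  assumes "is_dot_diagram \<Sigma> F" "is_dot_diagram \<Sigma> G"
  shows "weight (dd_comp G F) l =
    weight F (\<lambda>d. l (glue_class F G (Inl d))) * weight G (\<lambda>d. l (glue_class F G (Inr d)))"
  using assms unfolding weight_def by (simp add: prod.Plus is_dot_diagram_iff)

text \<open>
  An assignment on the pushout is a pair of assignments that agree along the glued boundary; the
  sum over the intermediate index runs over their common boundary value.
\<close>

lemma state_sum_comp:
  assumes F: "is_dot_diagram \<Sigma> F" and G: "is_dot_diagram \<Sigma> G"
    and bF: "has_boundary F v w" and bG: "has_boundary G w u"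
  shows "state_sum (dd_comp G F) xs zs = (\<Sum>ys \<in> tuples X w. state_sum F xs ys * state_sum G ys zs)"
    (is "?lhs = ?rhs")
proof -
  let ?q = "glue_class F G"
  have n: "NOut F = length w" "NIn G = length w"
    using bF bG by (simp_all add: has_boundary_def)
  have wire: "\<And>i. i < NIn F \<Longrightarrow> ThIn F (Inr i) \<in> Dots F" "\<And>j. j < length w \<Longrightarrow> ThOut F (Inr j) \<in> Dots F"
    "\<And>i. i < length w \<Longrightarrow> ThIn G (Inr i) \<in> Dots G" "\<And>j. j < NOut G \<Longrightarrow> ThOut G (Inr j) \<in> Dots G"
    using F G n by (simp_all add: is_dot_diagram_iff)
  \<comment> \<open>The boundary value is read on the side of \<open>F\<close>; the side of
    \<open>G\<close> gives the same by \<open>glue_class_eq\<close>.\<close>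
  define mid where "mid \<nu> = map (\<lambda>j. \<nu> (?q (Inl (ThOut F (Inr j))))) [0..<length w]"
    for \<nu> :: "_ \<Rightarrow> 'x"
  define split where "split \<nu> = (mid \<nu>, restrict (\<lambda>d. \<nu> (?q (Inl d))) (Dots F),
      restrict (\<lambda>d. \<nu> (?q (Inr d))) (Dots G))" for \<nu> :: "_ \<Rightarrow> 'x"
  \<comment> \<open>On triples in \<open>S\<close> the two assignments agree along the boundary, so
    each class carries one value and \<open>the_elem\<close> extracts it.\<close>
  define merge where "merge = (\<lambda>(ys :: 'x list, l :: _ \<Rightarrow> 'x, k :: _ \<Rightarrow> 'x).
      restrict (\<lambda>C. the_elem (case_sum l k ` C)) (Dots (dd_comp G F)))"
  \<comment> \<open>\<open>ys\<close> is already determined by \<open>l\<close>, so carrying it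
    along causes no overcounting; it lets the nested sum over \<open>ys\<close> and pairs become one
    sum over \<open>S\<close>.\<close>
  define S where "S = (SIGMA ys : tuples X w. states F xs ys \<times> states G ys zs)"
  have agree: "\<And>j. j < NOut F \<Longrightarrow> l (ThOut F (Inr j)) = k (ThIn G (Inr j))" if "(ys, l, k) \<in> S" for ys l k
    using that by (simp add: S_def states_iff n)
  have mergeF: "merge (ys, l, k) (?q (Inl d)) = l d" if "(ys, l, k) \<in> S" "d \<in> Dots F" for ys l k d
    using that the_elem_glue_class[of F l k G, OF agree[OF that(1)]] by (simp add: merge_def glue_class_in_Dots)
  have mergeG: "merge (ys, l, k) (?q (Inr d)) = k d" if "(ys, l, k) \<in> S" "d \<in> Dots G" for ys l k d
    using that the_elem_glue_class[of F l k G, OF agree[OF that(1)]] by (simp add: merge_def glue_class_in_Dots)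
  have split: "split \<nu> \<in> S" if \<nu>: "\<nu> \<in> states (dd_comp G F) xs zs" for \<nu>
  proof -
    have lab: "\<nu> (?q x) \<in> X (case_sum (DLab F) (DLab G) x)" if "x \<in> Dots F <+> Dots G" for x
    proof -
      have "?q x \<in> Dots (dd_comp G F)" using that by (simp add: quotientI)
      then have "\<nu> (?q x) \<in> X (DLab (dd_comp G F) (?q x))"
        using \<nu> unfolding states_iff by blast
      then show ?thesis by (simp add: DLab_dd_comp[OF bF bG])
    qed
    have "\<nu> (?q (Inl d)) \<in> X (DLab F d)" if "d \<in> Dots F" for d
      using lab[of "Inl d"] that by auto
    moreover have "\<nu> (?q (Inr d)) \<in> X (DLab G d)" if "d \<in> Dots G" for d
      using lab[of "Inr d"] that by auto
    moreover have "\<And>j. j < length w \<Longrightarrow> ?q (Inr (ThIn G (Inr j))) = ?q (Inl (ThOut F (Inr j)))"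
      using glue_class_eq[of _ F G] n by simp
    moreover have "\<And>i. i < NIn F \<Longrightarrow> \<nu> (?q (Inl (ThIn F (Inr i)))) = xs ! i"
      "\<And>j. j < NOut G \<Longrightarrow> \<nu> (?q (Inr (ThOut G (Inr j)))) = zs ! j"
      using \<nu> by (simp_all add: states_iff)
    moreover have "\<And>j. j < length w \<Longrightarrow> DLab F (ThOut F (Inr j)) = w ! j"
      using bF by (simp add: has_boundary_def)
    ultimately show ?thesis
      using wire by (auto simp: S_def split_def mid_def states_iff n tuples_iff_nth) metis
  qed
  have "?rhs = (\<Sum>ys \<in> tuples X w. \<Sum>(l, k) \<in> states F xs ys \<times> states G ys zs. weight F l * weight G k)"
    by (simp add: state_sum_def sum_product sum.cartesian_product)
  also have "\<dots> = (\<Sum>(ys, l, k) \<in> S. weight F l * weight G k)"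
    unfolding S_def by (subst sum.Sigma) (auto simp: finite_tup finite_states F G)
  also have "\<dots> = ?lhs"
    unfolding state_sum_def
  proof (rule sum.reindex_bij_witness[where j = merge and i = split], goal_cases)
    case (1 a)
    obtain ys l k where a: "a = (ys, l, k)" by (cases a)
    have S: "(ys, l, k) \<in> S" using 1 a by simp
    have "mid (merge (ys, l, k)) = ys"
      using S wire by (intro nth_equalityI)
        (auto simp: mid_def mergeF[OF S] S_def states_iff n length_tuples)
    moreover have "restrict (\<lambda>d. merge (ys, l, k) (?q (Inl d))) (Dots F) = l"
      using S mergeF[OF S] states_restrict[of l F] by (auto simp: S_def cong: restrict_cong)
    moreover have "restrict (\<lambda>d. merge (ys, l, k) (?q (Inr d))) (Dots G) = k"
      using S mergeG[OF S] states_restrict[of k G] by (auto simp: S_def cong: restrict_cong)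
    ultimately show ?case by (simp add: a split_def)
  next
    case (2 a)
    obtain ys l k where a: "a = (ys, l, k)" by (cases a)
    have S: "(ys, l, k) \<in> S" using 2 a by simp
    have "merge (ys, l, k) C \<in> X (DLab (dd_comp G F) C)" if C: "C \<in> Dots (dd_comp G F)" for C
    proof -
      obtain x where x: "x \<in> Dots F <+> Dots G" "C = ?q x"
        using C unfolding dd_comp_simps by (rule quotientE)
      then show ?thesis
        using S mergeF[OF S] mergeG[OF S]
        by (auto simp: DLab_dd_comp[OF bF bG] S_def states_iff)
    qed
    moreover have "merge (ys, l, k) \<in> extensional (Dots (dd_comp G F))"
      by (simp add: merge_def)
    ultimately show ?case
      using S wire by (simp add: a states_iff mergeF[OF S] mergeG[OF S]) (simp add: S_def states_iff)
  next
    case (3 \<nu>)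
    define l k where "l = (\<lambda>d. \<nu> (?q (Inl d)))" and "k = (\<lambda>d. \<nu> (?q (Inr d)))"
    have S: "(mid \<nu>, restrict l (Dots F), restrict k (Dots G)) \<in> S"
      using split[OF 3] by (simp add: split_def l_def k_def)
    have "merge (mid \<nu>, restrict l (Dots F), restrict k (Dots G)) C = \<nu> C" for C
    proof (cases "C \<in> Dots (dd_comp G F)")
      case True
      then obtain x where x: "x \<in> Dots F <+> Dots G" "C = ?q x"
        unfolding dd_comp_simps by (rule quotientE)
      then show ?thesis
        using mergeF[OF S] mergeG[OF S] by (auto simp: l_def k_def)
    next
      case False
      have "\<nu> \<in> extensional (Dots (dd_comp G F))"
        using 3 unfolding states_iff by blast
      then have "\<nu> C = undefined" using False by (rule extensional_arb)
      then show ?thesis using False by (simp add: merge_def del: dd_comp_simps)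
    qed
    then show ?case by (auto simp: split_def l_def k_def)
  next
    case (4 \<nu>)
    then show ?case by (rule split)
  next
    case (5 a)
    obtain ys l k where a: "a = (ys, l, k)" by (cases a)
    have S: "(ys, l, k) \<in> S" using 5 a by simp
    have "weight F (\<lambda>d. merge a (?q (Inl d))) = weight F l"
      "weight G (\<lambda>d. merge a (?q (Inr d))) = weight G k"
      by (rule weight_cong[OF F], simp add: a mergeF[OF S])
        (rule weight_cong[OF G], simp add: a mergeG[OF S])
    then show ?case by (simp add: weight_comp[OF F G] a)
  qed
  finally show ?thesis by simp
qed

text \<open>
  Composites and products of arrows are unions over representatives, so they preserve
  \<open>denotes\<close> without knowing that composition of diagrams respects isomorphism.
\<close>

definition denotes :: "('o, 'm) dot_arrow \<Rightarrow> 'o list \<Rightarrow> 'o list \<Rightarrow> ('x list \<Rightarrow> 'x list \<Rightarrow> 'k) \<Rightarrow> bool" where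
  "denotes f v w P \<longleftrightarrow> f \<noteq> {} \<and>
     (\<forall>H \<in> f. is_dot_diagram \<Sigma> H \<and> has_boundary H v w \<and>
       (\<forall>xs \<in> tuples X v. \<forall>ys \<in> tuples X w. state_sum H xs ys = P xs ys))"

lemma denotes_cong:
  assumes "denotes f v w P" "\<And>xs ys. xs \<in> tuples X v \<Longrightarrow> ys \<in> tuples X w \<Longrightarrow> P xs ys = Q xs ys"
  shows "denotes f v w Q"
  using assms unfolding denotes_def by simp

lemma dd_class_member:
  fixes F :: "('o, 'm, 'b, 'd) dot_diagram"
  assumes F: "is_dot_diagram \<Sigma> F" and b: "has_boundary F v w" and H: "H \<in> dd_class \<Sigma> F"
  shows "is_dot_diagram \<Sigma> H" "has_boundary H v w" "state_sum H xs ys = state_sum F xs ys"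
proof -
  have iso: "dd_isomorphic \<Sigma> F H" and dH: "is_dot_diagram \<Sigma> H"
    using H by (simp_all add: dd_class_def)
  show "is_dot_diagram \<Sigma> H" by (rule dH)
  show "has_boundary H v w"
    using iso b has_boundary_homomorphism[OF F] by (metis dd_isomorphicE)
  show "state_sum H xs ys = state_sum F xs ys"
    using state_sum_isomorphic[OF F dH iso] by simp
qed

lemma denotes_dd_class:
  assumes F: "is_dot_diagram \<Sigma> F" and b: "has_boundary F v w"
    and "\<And>xs ys. xs \<in> tuples X v \<Longrightarrow> ys \<in> tuples X w \<Longrightarrow> state_sum F xs ys = P xs ys"
  shows "denotes (dd_class \<Sigma> F) v w P"
  using assms(3) dd_class_member[OF F b] dd_class_nonempty[OF F] unfolding denotes_def by simp

lemma denotes_UN: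
  assumes "I \<noteq> {}" "\<And>i. i \<in> I \<Longrightarrow> denotes (f i) v w P"
  shows "denotes (\<Union>i \<in> I. f i) v w P"
  using assms unfolding denotes_def by fastforce

lemma denotes_comp:
  assumes f: "denotes f v w P" and g: "denotes g w u Q"
  shows "denotes (dot_comp \<Sigma> g f) v u (\<lambda>xs zs. \<Sum>ys \<in> tuples X w. P xs ys * Q ys zs)"
proof -
  have "denotes (dd_class \<Sigma> (dd_comp G F)) v u (\<lambda>xs zs. \<Sum>ys \<in> tuples X w. P xs ys * Q ys zs)"
    if "G \<in> g" "F \<in> f" for F G
  proof -
    have F: "is_dot_diagram \<Sigma> F" "has_boundary F v w"
      "\<And>xs ys. xs \<in> tuples X v \<Longrightarrow> ys \<in> tuples X w \<Longrightarrow> state_sum F xs ys = P xs ys"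
      using f that unfolding denotes_def by blast+
    have G: "is_dot_diagram \<Sigma> G" "has_boundary G w u"
      "\<And>xs ys. xs \<in> tuples X w \<Longrightarrow> ys \<in> tuples X u \<Longrightarrow> state_sum G xs ys = Q xs ys"
      using g that unfolding denotes_def by blast+
    show ?thesis
      using F G by (intro denotes_dd_class is_dot_diagram_comp has_boundary_comp)
        (auto simp: state_sum_comp[of F G v w u] intro!: sum.cong)
  qed
  moreover have "f \<noteq> {}" "g \<noteq> {}" using f g by (auto simp: denotes_def)
  ultimately show ?thesis
    unfolding dot_comp_def by (intro denotes_UN) auto
qed

lemma denotes_tensor:
  assumes f: "denotes f v w P" and g: "denotes g v' w' Q"
  shows "denotes (dot_tensor \<Sigma> f g) (v @ v') (w @ w') (\<lambda>xs ys.
    P (take (length v) xs) (take (length w) ys) * Q (drop (length v) xs) (drop (length w) ys))"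
    (is "denotes _ _ _ ?R")
proof -
  have "denotes (dd_class \<Sigma> (dd_tensor F G)) (v @ v') (w @ w') ?R" if "F \<in> f" "G \<in> g" for F G
  proof -
    have F: "is_dot_diagram \<Sigma> F" "has_boundary F v w"
      "\<And>xs ys. xs \<in> tuples X v \<Longrightarrow> ys \<in> tuples X w \<Longrightarrow> state_sum F xs ys = P xs ys"
      using f that unfolding denotes_def by blast+
    have G: "is_dot_diagram \<Sigma> G" "has_boundary G v' w'"
      "\<And>xs ys. xs \<in> tuples X v' \<Longrightarrow> ys \<in> tuples X w' \<Longrightarrow> state_sum G xs ys = Q xs ys"
      using g that unfolding denotes_def by blast+
    have n: "NIn F = length v" "NOut F = length w"
      using F(2) by (simp_all add: has_boundary_def)
    show ?thesis
    proof (rule denotes_dd_class)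
      fix xs ys assume *: "xs \<in> tuples X (v @ v')" "ys \<in> tuples X (w @ w')"
      show "state_sum (dd_tensor F G) xs ys = ?R xs ys"
        using * length_tuples[OF *(1)] length_tuples[OF *(2)]
        by (subst state_sum_tensor[OF F(1) G(1)])
          (simp_all add: n F(3) G(3) take_in_tuples drop_in_tuples)
    qed (intro is_dot_diagram_tensor has_boundary_tensor F G)+
  qed
  moreover have "f \<noteq> {}" "g \<noteq> {}" using f g by (auto simp: denotes_def)
  ultimately show ?thesis
    unfolding dot_tensor_def by (intro denotes_UN) auto
qed

text \<open>The entry point for arbitrary arrows: once some \<open>P\<close> is available, the
  functor laws become identities between matrices and no diagrams are involved.\<close>

lemma denotes_hom:
  assumes "f \<in> dot_hom \<Sigma> v w"
  obtains P where "denotes f v w P"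
  using assms denotes_dd_class unfolding dot_hom_def by blast

section \<open>Arrows denoting graphs of maps and converse graphs\<close>

definition denotes_map :: "('o, 'm) dot_arrow \<Rightarrow> 'o list \<Rightarrow> 'o list \<Rightarrow> ('x list \<Rightarrow> 'x list) \<Rightarrow> bool" where
  "denotes_map f v w h \<longleftrightarrow> denotes f v w (\<lambda>xs ys. of_bool (ys = h xs)) \<and>
     (\<forall>xs \<in> tuples X v. h xs \<in> tuples X w)"

text \<open>The transposed case, needed for the multiplication, whose matrix is the graph of
  duplication read backwards. In both cases composites are found by composing functions instead of
  summing, here in the opposite order.\<close>

definition denotes_comap :: "('o, 'm) dot_arrow \<Rightarrow> 'o list \<Rightarrow> 'o list \<Rightarrow> ('x list \<Rightarrow> 'x list) \<Rightarrow> bool" where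
  "denotes_comap f v w h \<longleftrightarrow> denotes f v w (\<lambda>xs ys. of_bool (xs = h ys)) \<and>
     (\<forall>ys \<in> tuples X w. h ys \<in> tuples X v)"

lemma denotes_map_cong:
  assumes "denotes_map f v w h" "\<And>xs. xs \<in> tuples X v \<Longrightarrow> h xs = h' xs"
  shows "denotes_map f v w h'"
  using assms unfolding denotes_map_def by (auto intro: denotes_cong)

lemma denotes_comap_cong:
  assumes "denotes_comap f v w h" "\<And>xs. xs \<in> tuples X w \<Longrightarrow> h xs = h' xs"
  shows "denotes_comap f v w h'"
  using assms unfolding denotes_comap_def by (auto intro: denotes_cong)

lemma sum_of_bool_delta:
  fixes f :: "'i \<Rightarrow> 'k"
  assumes "finite S" "a \<in> S"
  shows "(\<Sum>y \<in> S. of_bool (y = a) * f y) = f a" "(\<Sum>y \<in> S. f y * of_bool (y = a)) = f a"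
proof -
  have "(\<Sum>y \<in> S. of_bool (y = a) * f y) = (\<Sum>y \<in> S. if y = a then f y else 0)"
    by (rule sum.cong) auto
  then show "(\<Sum>y \<in> S. of_bool (y = a) * f y) = f a"
    using assms by simp
  then show "(\<Sum>y \<in> S. f y * of_bool (y = a)) = f a"
    by (simp add: mult.commute)
qed

lemma denotes_map_comp:
  assumes f: "denotes_map f v w h" and g: "denotes_map g w u h'"
  shows "denotes_map (dot_comp \<Sigma> g f) v u (h' \<circ> h)"
  unfolding denotes_map_def
proof
  have "denotes (dot_comp \<Sigma> g f) v u (\<lambda>xs zs. \<Sum>ys \<in> tuples X w. of_bool (ys = h xs) * of_bool (zs = h' ys))"
    using f g unfolding denotes_map_def by (intro denotes_comp) auto
  then show "denotes (dot_comp \<Sigma> g f) v u (\<lambda>xs ys. of_bool (ys = (h' \<circ> h) xs))"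
    by (rule denotes_cong) (use f in \<open>simp add: denotes_map_def sum_of_bool_delta finite_tup\<close>)
qed (use f g in \<open>auto simp: denotes_map_def\<close>)

lemma denotes_comap_comp:
  assumes f: "denotes_comap f v w h" and g: "denotes_comap g w u h'"
  shows "denotes_comap (dot_comp \<Sigma> g f) v u (h \<circ> h')"
  unfolding denotes_comap_def
proof
  have "denotes (dot_comp \<Sigma> g f) v u (\<lambda>xs zs. \<Sum>ys \<in> tuples X w. of_bool (xs = h ys) * of_bool (ys = h' zs))"
    using f g unfolding denotes_comap_def by (intro denotes_comp) auto
  then show "denotes (dot_comp \<Sigma> g f) v u (\<lambda>xs ys. of_bool (xs = (h \<circ> h') ys))"
    by (rule denotes_cong) (use g in \<open>simp add: denotes_comap_def sum_of_bool_delta finite_tup\<close>)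
qed (use f g in \<open>auto simp: denotes_comap_def\<close>)

text \<open>Merges the deltas on the two blocks of a word into a single delta on the whole
  word.\<close>

lemma eq_append_iff_take_drop:
  assumes "length xs = n"
  shows "ys = xs @ zs \<longleftrightarrow> take n ys = xs \<and> drop n ys = zs"
  using assms by (metis append_eq_conv_conj append_take_drop_id)

lemma denotes_map_tensor:
  assumes f: "denotes_map f v w h" and g: "denotes_map g v' w' h'"
  shows "denotes_map (dot_tensor \<Sigma> f g) (v @ v') (w @ w')
    (\<lambda>xs. h (take (length v) xs) @ h' (drop (length v) xs))"
  unfolding denotes_map_def
proof
  have "denotes (dot_tensor \<Sigma> f g) (v @ v') (w @ w') (\<lambda>xs ys.
     of_bool (take (length w) ys = h (take (length v) xs)) *
     of_bool (drop (length w) ys = h' (drop (length v) xs)))"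
    using f g unfolding denotes_map_def by (intro denotes_tensor) auto
  then show "denotes (dot_tensor \<Sigma> f g) (v @ v') (w @ w')
     (\<lambda>xs ys. of_bool (ys = h (take (length v) xs) @ h' (drop (length v) xs)))"
  proof (rule denotes_cong)
    fix xs ys assume "xs \<in> tuples X (v @ v')"
    then have "length (h (take (length v) xs)) = length w"
      using f unfolding denotes_map_def by (meson length_tuples take_in_tuples)
    then show "of_bool (take (length w) ys = h (take (length v) xs)) *
        of_bool (drop (length w) ys = h' (drop (length v) xs)) =
      (of_bool (ys = h (take (length v) xs) @ h' (drop (length v) xs)) :: 'k)"
      by (simp add: eq_append_iff_take_drop)
  qed
qed (use f g in \<open>auto simp: denotes_map_def intro!: append_in_tuples take_in_tuples drop_in_tuples\<close>)

lemma denotes_comap_tensor: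
  assumes f: "denotes_comap f v w h" and g: "denotes_comap g v' w' h'"
  shows "denotes_comap (dot_tensor \<Sigma> f g) (v @ v') (w @ w')
    (\<lambda>ys. h (take (length w) ys) @ h' (drop (length w) ys))"
  unfolding denotes_comap_def
proof
  have "denotes (dot_tensor \<Sigma> f g) (v @ v') (w @ w') (\<lambda>xs ys.
     of_bool (take (length v) xs = h (take (length w) ys)) *
     of_bool (drop (length v) xs = h' (drop (length w) ys)))"
    using f g unfolding denotes_comap_def by (intro denotes_tensor) auto
  then show "denotes (dot_tensor \<Sigma> f g) (v @ v') (w @ w')
     (\<lambda>xs ys. of_bool (xs = h (take (length w) ys) @ h' (drop (length w) ys)))"
  proof (rule denotes_cong)
    fix xs ys assume "ys \<in> tuples X (w @ w')"
    then have "length (h (take (length w) ys)) = length v"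
      using f unfolding denotes_comap_def by (meson length_tuples take_in_tuples)
    then show "of_bool (take (length v) xs = h (take (length w) ys)) *
        of_bool (drop (length v) xs = h' (drop (length w) ys)) =
      (of_bool (xs = h (take (length w) ys) @ h' (drop (length w) ys)) :: 'k)"
      by (simp add: eq_append_iff_take_drop)
  qed
qed (use f g in \<open>auto simp: denotes_comap_def intro!: append_in_tuples take_in_tuples drop_in_tuples\<close>)

section \<open>Identities, swaps and spiders\<close>

lemma state_sum_box_free:
  assumes "\<And>i. i < m \<Longrightarrow> f i < length w" "\<And>j. j < n \<Longrightarrow> g j < length w"
  shows "state_sum (box_free w m f n g) xs ys =
    of_nat (card {l \<in> tuples X w. (\<forall>i < m. l ! f i = xs ! i) \<and> (\<forall>j < n. l ! g j = ys ! j)})"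
proof -
  let ?S = "states (box_free w m f n g) xs ys"
  let ?T = "{l \<in> tuples X w. (\<forall>i < m. l ! f i = xs ! i) \<and>
      (\<forall>j < n. l ! g j = ys ! j)}"
  have "bij_betw (\<lambda>l. map l [0..<length w]) ?S ?T"
  proof (rule bij_betw_byWitness[where f' = "\<lambda>l. restrict (nth l) {..<length w}"])
    show "\<forall>l \<in> ?S. restrict (nth (map l [0..<length w])) {..<length w} = l"
    proof
      fix l assume l: "l \<in> ?S"
      have "restrict (nth (map l [0..<length w])) {..<length w} = restrict l {..<length w}"
        by (rule restrict_ext) simp
      then show "restrict (nth (map l [0..<length w])) {..<length w} = l"
        using states_restrict[OF l] by simp
    qed
    show "\<forall>l \<in> ?T. map (restrict (nth l) {..<length w}) [0..<length w] = l"
      by (auto simp: tuples_iff_nth intro: nth_equalityI)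
    show "(\<lambda>l. map l [0..<length w]) ` ?S \<subseteq> ?T"
      using assms by (auto simp: states_iff tuples_iff_nth)
    show "(\<lambda>l. restrict (nth l) {..<length w}) ` ?T \<subseteq> ?S"
      using assms by (auto simp: states_iff tuples_iff_nth)
  qed
  \<comment> \<open>Without boxes every weight is an empty product, so the state sum is a
    cardinality.\<close>
  then show ?thesis
    by (simp add: state_sum_def weight_def bij_betw_same_card)
qed

text \<open>Meant for diagrams in which every dot touches the boundary: then the boundary values
  leave at most one assignment, \<open>c xs ys\<close>, which is admissible when
  \<open>C xs ys\<close> holds, and the count is 0 or 1.\<close>

lemma denotes_box_free:
  assumes "w \<in> lists (SObj \<Sigma>)" "\<And>i. i < m \<Longrightarrow> f i < length w" "\<And>j. j < n \<Longrightarrow> g j < length w"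
    and "m = length v" "n = length u" "\<And>i. i < m \<Longrightarrow> w ! f i = v ! i" "\<And>j. j < n \<Longrightarrow> w ! g j = u ! j"
    and "\<And>xs ys l. xs \<in> tuples X v \<Longrightarrow> ys \<in> tuples X u \<Longrightarrow>
      (l \<in> tuples X w \<and> (\<forall>i < m. l ! f i = xs ! i) \<and> (\<forall>j < n. l ! g j = ys ! j))
        \<longleftrightarrow> C xs ys \<and> l = c xs ys"
  shows "denotes (dd_class \<Sigma> (box_free w m f n g)) v u (\<lambda>xs ys. of_bool (C xs ys))"
proof (rule denotes_dd_class)
  show "is_dot_diagram \<Sigma> (box_free w m f n g)"
    using assms by (intro is_dot_diagram_box_free)
  show "has_boundary (box_free w m f n g) v u"
    using assms by (simp add: has_boundary_def)
  fix xs ys assume *: "xs \<in> tuples X v" "ys \<in> tuples X u"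
  have "{l \<in> tuples X w. (\<forall>i < m. l ! f i = xs ! i) \<and>
      (\<forall>j < n. l ! g j = ys ! j)} = (if C xs ys then {c xs ys} else {})"
    using assms(2,3) assms(8)[OF *] by auto
  then show "state_sum (box_free w m f n g) xs ys = of_bool (C xs ys)"
    using state_sum_box_free[OF assms(2,3)] by simp
qed

lemma denotes_id:
  assumes "w \<in> lists (SObj \<Sigma>)"
  shows "denotes_map (dot_id \<Sigma> w) w w id" "denotes_comap (dot_id \<Sigma> w) w w id"
proof -
  have "denotes (dot_id \<Sigma> w) w w (\<lambda>xs ys. of_bool (ys = xs))"
    unfolding dot_id_def
    by (rule denotes_box_free[where c = "\<lambda>xs ys. xs"])
      (use assms in \<open>auto simp: tuples_iff_nth list_eq_iff_nth_eq\<close>)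
  then show "denotes_map (dot_id \<Sigma> w) w w id" "denotes_comap (dot_id \<Sigma> w) w w id"
    by (simp_all add: denotes_map_def denotes_comap_def eq_commute)
qed

lemma denotes_swap:
  assumes "v \<in> lists (SObj \<Sigma>)" "w \<in> lists (SObj \<Sigma>)"
  shows "denotes_map (dot_swap \<Sigma> v w) (v @ w) (w @ v) (\<lambda>xs. drop (length v) xs @ take (length v) xs)"
    (is ?A)
    and "denotes_comap (dot_swap \<Sigma> v w) (v @ w) (w @ v) (\<lambda>ys. drop (length w) ys @ take (length w) ys)"
    (is ?B)
proof -
  have swap: "ys = drop (length v) xs @ take (length v) xs \<longleftrightarrow>
      (\<forall>j < length v + length w.
        xs ! (if j < length w then length v + j else j - length w) = ys ! j)"
    if "length xs = length v + length w" "length ys = length v + length w" for xs ys :: "'x list"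
  proof -
    let ?L = "drop (length v) xs @ take (length v) xs"
    have "length ys = length ?L" using that by simp
    then have "ys = ?L \<longleftrightarrow> (\<forall>j < length v + length w. ys ! j = ?L ! j)"
      using that(2) nth_equalityI[of ys ?L] by auto
    moreover have "?L ! j = xs ! (if j < length w then length v + j else j - length w)"
      if "j < length v + length w" for j
      using that \<open>length xs = _\<close> by (simp add: nth_append)
    ultimately show ?thesis by metis
  qed
  have 1: "denotes (dot_swap \<Sigma> v w) (v @ w) (w @ v)
      (\<lambda>xs ys. of_bool (ys = drop (length v) xs @ take (length v) xs))"
    unfolding dot_swap_def
  proof (rule denotes_box_free[where c = "\<lambda>xs ys. xs"])
    fix xs ys l assume *: "xs \<in> tuples X (v @ w)" "ys \<in> tuples X (w @ v)"
    have len: "length xs = length v + length w" "length ys = length v + length w"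
      using *[THEN length_tuples] by simp_all
    have "(l \<in> tuples X (v @ w) \<and> (\<forall>i < length v + length w. l ! i = xs ! i)) \<longleftrightarrow> l = xs"
      using *(1) len(1) nth_equalityI[of l xs] by (auto simp: length_tuples[of l])
    then show "(l \<in> tuples X (v @ w) \<and> (\<forall>i < length v + length w. l ! i = xs ! i) \<and>
      (\<forall>j < length v + length w.
        l ! (if j < length w then length v + j else j - length w) = ys ! j)) \<longleftrightarrow>
      ys = drop (length v) xs @ take (length v) xs \<and> l = xs"
      using swap[OF len] by blast
  qed (use assms in \<open>auto simp: nth_append\<close>)
  then show ?A
    by (auto simp: denotes_map_def intro: append_in_tuples take_in_tuples drop_in_tuples)
  \<comment> \<open>Exchanging the blocks twice is the identity, so the graph of one exchange is the
    converse graph of the other.\<close>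
  have "ys = drop (length v) xs @ take (length v) xs \<longleftrightarrow> xs = drop (length w) ys @ take (length w) ys"
    if "length xs = length v + length w" "length ys = length v + length w" for xs ys :: "'x list"
  proof -
    have "length (drop (length v) xs) = length w" "length (drop (length w) ys) = length v"
      using that by simp_all
    from this[THEN eq_append_iff_take_drop] show ?thesis by metis
  qed
  then have "denotes (dot_swap \<Sigma> v w) (v @ w) (w @ v)
      (\<lambda>xs ys. of_bool (xs = drop (length w) ys @ take (length w) ys))"
    by (intro denotes_cong[OF 1]) (simp add: length_tuples)
  then show ?B
    by (auto simp: denotes_comap_def intro: append_in_tuples take_in_tuples drop_in_tuples)
qed

text \<open>With at least one leg the index of the single dot can be read off the boundary as
  \<open>hd (xs @ ys)\<close>. Without legs the state sum would be the number of indices of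
  \<open>A\<close>.\<close>

lemma denotes_spider:
  assumes "A \<in> SObj \<Sigma>" "0 < m + n"
  shows "denotes (dot_spider \<Sigma> A m n) (replicate m A) (replicate n A)
    (\<lambda>xs ys. of_bool (\<forall>x \<in> set (xs @ ys). x = hd (xs @ ys)))"
  unfolding dot_spider_def
proof (rule denotes_box_free[where c = "\<lambda>xs ys. [hd (xs @ ys)]"])
  fix xs ys l assume *: "xs \<in> tuples X (replicate m A)" "ys \<in> tuples X (replicate n A)"
  have len: "length xs = m" "length ys = n" using *[THEN length_tuples] by simp_all
  then have ne: "xs @ ys \<noteq> []" using assms(2) by auto
  have sub: "\<forall>x \<in> set (xs @ ys). x \<in> X A"
    using * by (auto simp: tuples_iff_nth in_set_conv_nth)
  have legs: "(\<forall>x \<in> set xs. x = z) \<longleftrightarrow> (\<forall>i < m. z = xs ! i)"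
    "(\<forall>y \<in> set ys. y = z) \<longleftrightarrow> (\<forall>j < n. z = ys ! j)" for z
    using len by (auto simp: all_set_conv_all_nth)
  have "(l \<in> tuples X [A] \<and> (\<forall>i < m. l ! 0 = xs ! i) \<and> (\<forall>j < n. l ! 0 = ys ! j)) \<longleftrightarrow>
      (\<exists>z. l = [z] \<and> z \<in> X A \<and> (\<forall>x \<in> set (xs @ ys). x = z))"
    by (auto simp: tuples_def list_all2_Cons2 ball_Un legs)
  also have "\<dots> \<longleftrightarrow> (\<forall>x \<in> set (xs @ ys). x = hd (xs @ ys)) \<and> l = [hd (xs @ ys)]"
    using hd_in_set[OF ne] sub by (metis (full_types))
  finally show "(l \<in> tuples X [A] \<and> (\<forall>i < m. l ! 0 = xs ! i) \<and> (\<forall>j < n. l ! 0 = ys ! j)) \<longleftrightarrow>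
    (\<forall>x \<in> set (xs @ ys). x = hd (xs @ ys)) \<and> l = [hd (xs @ ys)]" .
qed (use assms in auto)

lemma denotes_spiders:
  assumes "A \<in> SObj \<Sigma>"
  shows "denotes_comap (dot_spider \<Sigma> A 2 1) [A, A] [A] (\<lambda>ys. ys @ ys)"
    and "denotes_map (dot_spider \<Sigma> A 1 2) [A] [A, A] (\<lambda>xs. xs @ xs)"
    and "denotes (dot_spider \<Sigma> A 0 1) [] [A] (\<lambda>_ _. 1)"
    and "denotes (dot_spider \<Sigma> A 1 0) [A] [] (\<lambda>_ _. 1)"
proof -
  have r: "replicate 2 A = [A, A]" "replicate 1 A = [A]" "replicate 0 A = []"
    by (simp_all add: numeral_2_eq_2)
  have t1: "\<exists>x. xs = [x] \<and> x \<in> X A" if "xs \<in> tuples X [A]" for xs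
    using that by (auto simp: tuples_Cons)
  have t2: "\<exists>x y. xs = [x, y] \<and> x \<in> X A \<and> y \<in> X A" if "xs \<in> tuples X [A, A]" for xs
    using that by (auto simp: tuples_Cons)
  show "denotes_comap (dot_spider \<Sigma> A 2 1) [A, A] [A] (\<lambda>ys. ys @ ys)"
    unfolding denotes_comap_def
    using denotes_spider[OF assms, of 2 1] unfolding r
    by (auto elim!: denotes_cong dest!: t1 t2)
  show "denotes_map (dot_spider \<Sigma> A 1 2) [A] [A, A] (\<lambda>xs. xs @ xs)"
    unfolding denotes_map_def
    using denotes_spider[OF assms, of 1 2] unfolding r
    by (auto elim!: denotes_cong dest!: t1 t2)
  show "denotes (dot_spider \<Sigma> A 0 1) [] [A] (\<lambda>_ _. 1)"
    using denotes_spider[OF assms, of 0 1] unfolding r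
    by (auto elim!: denotes_cong dest!: t1)
  show "denotes (dot_spider \<Sigma> A 1 0) [A] [] (\<lambda>_ _. 1)"
    using denotes_spider[OF assms, of 1 0] unfolding r
    by (auto elim!: denotes_cong dest!: t1)
qed

section \<open>The Frobenius structure on words\<close>

lemma denotes_mu:
  "w \<in> lists (SObj \<Sigma>) \<Longrightarrow> denotes_comap (dot_mu \<Sigma> w) (w @ w) w (\<lambda>ys. ys @ ys)"
proof (induction w)
  case Nil
  have "denotes_comap (dot_id \<Sigma> []) [] [] id" by (rule denotes_id) simp
  then show ?case by (auto elim!: denotes_comap_cong)
next
  case (Cons A w)
  then have A: "A \<in> SObj \<Sigma>" "[A] \<in> lists (SObj \<Sigma>)" and w: "w \<in> lists (SObj \<Sigma>)" by auto
  \<comment> \<open>Read from output to input: the first letter and the rest are duplicated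
    separately, \<open>y # zs\<close> giving \<open>y y zs zs\<close>, and the swap in the middle
    turns this into \<open>y zs y zs\<close>.\<close>
  note pre = denotes_comap_tensor[OF denotes_comap_tensor[OF denotes_id(2)[OF A(2)] denotes_swap(2)[OF w A(2)]]
      denotes_id(2)[OF w]]
  note post = denotes_comap_tensor[OF denotes_spiders(1)[OF A(1)] Cons.IH[OF w]]
  show ?case
    unfolding dot_mu.simps append_Cons
    \<comment> \<open>The intermediate words of the two factors agree only up to associativity of
      concatenation; the simplified instances make them coincide.\<close>
    by (rule denotes_comap_cong[OF denotes_comap_comp[OF pre[simplified append.simps append_assoc] post[simplified append.simps append_assoc]]])
      (auto simp: tuples_Cons dest!: length_tuples)
qed

lemma denotes_delta:
  "w \<in> lists (SObj \<Sigma>) \<Longrightarrow> denotes_map (dot_delta \<Sigma> w) w (w @ w) (\<lambda>xs. xs @ xs)"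
proof (induction w)
  case Nil
  have "denotes_map (dot_id \<Sigma> []) [] [] id" by (rule denotes_id) simp
  then show ?case by (auto elim!: denotes_map_cong)
next
  case (Cons A w)
  then have A: "A \<in> SObj \<Sigma>" "[A] \<in> lists (SObj \<Sigma>)" and w: "w \<in> lists (SObj \<Sigma>)" by auto
  note post = denotes_map_tensor[OF denotes_map_tensor[OF denotes_id(1)[OF A(2)] denotes_swap(1)[OF A(2) w]]
      denotes_id(1)[OF w]]
  note pre = denotes_map_tensor[OF denotes_spiders(2)[OF A(1)] Cons.IH[OF w]]
  show ?case
    unfolding dot_delta.simps append_Cons
    by (rule denotes_map_cong[OF denotes_map_comp[OF pre[simplified append.simps append_assoc] post[simplified append.simps append_assoc]]])
      (auto simp: tuples_Cons dest!: length_tuples)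
qed

lemma denotes_eta: "w \<in> lists (SObj \<Sigma>) \<Longrightarrow> denotes (dot_eta \<Sigma> w) [] w (\<lambda>_ _. 1)"
proof (induction w)
  case Nil
  have "denotes_map (dot_id \<Sigma> []) [] [] id" by (rule denotes_id) simp
  then show ?case by (auto simp: denotes_map_def elim!: denotes_cong)
next
  case (Cons A w)
  then show ?case using denotes_tensor[OF denotes_spiders(3) Cons.IH] by simp
qed

lemma denotes_epsilon: "w \<in> lists (SObj \<Sigma>) \<Longrightarrow> denotes (dot_epsilon \<Sigma> w) w [] (\<lambda>_ _. 1)"
proof (induction w)
  case Nil
  have "denotes_map (dot_id \<Sigma> []) [] [] id" by (rule denotes_id) simp
  then show ?case by (auto simp: denotes_map_def elim!: denotes_cong)
next
  case (Cons A w)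
  then show ?case using denotes_tensor[OF denotes_spiders(4) Cons.IH] by simp
qed

end

section \<open>The hypergraph functor of an interpretation\<close>

text \<open>An index in \<open>Mat\<close> is a single element, so a word of indices is coded by
  nested pairs. Ending with \<open>Point\<close> sends the empty word to the unit object itself, at
  the price that a one-letter word acquires a trivial second component.\<close>

primrec tuple :: "'u elem list \<Rightarrow> 'u elem" where
  "tuple [] = Point"
| "tuple (x # xs) = Pr x (tuple xs)"

primrec untuple :: "'u elem \<Rightarrow> 'u elem list" where
  "untuple (Atom a) = []"
| "untuple Point = []"
| "untuple (Pr x y) = x # untuple y"

lemma untuple_tuple [simp]: "untuple (tuple xs) = xs"
  by (induction xs) auto

lemma tuple_eq_iff [simp]: "tuple xs = tuple ys \<longleftrightarrow> xs = ys"
  by (metis untuple_tuple)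

lemma Pr_in_set_prod [simp]: "Pr i j \<in> set_prod I J \<longleftrightarrow> i \<in> I \<and> j \<in> J"
  by (auto simp: set_prod_def)

lemma set_prodE:
  assumes "x \<in> set_prod I J"
  obtains i j where "x = Pr i j" "i \<in> I" "j \<in> J"
  using assms by (auto simp: set_prod_def)

lemma finite_set_prod [simp]: "finite I \<Longrightarrow> finite J \<Longrightarrow> finite (set_prod I J)"
  unfolding set_prod_def by (rule finite_image_set2) auto

section \<open>Calculus of 0-1 matrices\<close>

lemma MDom_mk_matrix [simp]: "MDom (mk_matrix I J e) = I"
  and MCod_mk_matrix [simp]: "MCod (mk_matrix I J e) = J"
  and Entry_mk_matrix: "Entry (mk_matrix I J e) i j = (if i \<in> I \<and> j \<in> J then e i j else 0)"
  by (simp_all add: mk_matrix_def)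

lemma mk_matrix_cong:
  assumes "\<And>i j. i \<in> I \<Longrightarrow> j \<in> J \<Longrightarrow> e i j = e' i j"
  shows "mk_matrix I J e = mk_matrix I J e'"
  using assms unfolding mk_matrix_def by (auto simp: fun_eq_iff)

lemma map_matrix_cong:
  assumes "\<And>i. i \<in> I \<Longrightarrow> h i = h' i"
  shows "map_matrix I J h = map_matrix I J h'"
  using assms unfolding map_matrix_def by (auto intro: mk_matrix_cong)

lemma mat_comp_mk_matrix:
  "mat_comp (mk_matrix J L e') (mk_matrix I J e) = mk_matrix I L (\<lambda>i k. \<Sum>j \<in> J. e i j * e' j k)"
  unfolding mat_comp_def MDom_mk_matrix MCod_mk_matrix
  by (rule mk_matrix_cong) (auto simp: Entry_mk_matrix intro!: sum.cong)

lemma mat_tensor_mk_matrix: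
  "mat_tensor (mk_matrix I J e) (mk_matrix I' J' e') =
    mk_matrix (set_prod I I') (set_prod J J') (\<lambda>x y. e (left x) (left y) * e' (right x) (right y))"
  unfolding mat_tensor_def MDom_mk_matrix MCod_mk_matrix
  by (rule mk_matrix_cong) (auto simp: Entry_mk_matrix elim!: set_prodE)

lemma mat_comp_map_right:
  fixes e :: "'u elem \<Rightarrow> 'u elem \<Rightarrow> 'k::semiring_1"
  assumes "finite J" "\<And>i. i \<in> I \<Longrightarrow> h i \<in> J"
  shows "mat_comp (mk_matrix J L e) (map_matrix I J h) = mk_matrix I L (\<lambda>i. e (h i))"
  unfolding map_matrix_def mat_comp_mk_matrix
proof (rule mk_matrix_cong, goal_cases)
  case (1 i k)
  have "(\<Sum>j \<in> J. (if j = h i then 1 else 0) * e j k) = (\<Sum>j \<in> J. if j = h i then e j k else 0)"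
    by (rule sum.cong) auto
  then show ?case using assms 1 by simp
qed

text \<open>Multiplying by the matrix of a map on this side sums over its fibres. For a bijection a
  fibre is a single point, found by the inverse \<open>g\<close>.\<close>

lemma mat_comp_map_left:
  fixes e :: "'u elem \<Rightarrow> 'u elem \<Rightarrow> 'k::semiring_1"
  assumes "finite J" "\<And>j. j \<in> J \<Longrightarrow> g (h j) = j" "\<And>l. l \<in> L \<Longrightarrow> g l \<in> J \<and> h (g l) = l"
  shows "mat_comp (map_matrix J L h) (mk_matrix I J e) = mk_matrix I L (\<lambda>i l. e i (g l))"
  unfolding map_matrix_def mat_comp_mk_matrix
proof (rule mk_matrix_cong, goal_cases)
  case (1 i l)
  have "(\<Sum>j \<in> J. e i j * (if l = h j then 1 else 0)) = (\<Sum>j \<in> J. if j = g l then e i j else 0)"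
    using assms(2,3) 1 by (intro sum.cong) auto
  then show ?case using assms 1 by simp
qed

lemma mat_comp_map_map:
  assumes "finite J" "\<And>i. i \<in> I \<Longrightarrow> h i \<in> J"
  shows "mat_comp (map_matrix J L g) (map_matrix I J h) =
    (map_matrix I L (\<lambda>i. g (h i)) :: ('u, 'k::semiring_1) matrix)"
  using mat_comp_map_right[OF assms] by (simp add: map_matrix_def)

lemma mat_tensor_map_map:
  "mat_tensor (map_matrix I J h) (map_matrix I' J' h') =
    (map_matrix (set_prod I I') (set_prod J J') (\<lambda>x. Pr (h (left x)) (h' (right x))) :: ('u, 'k::semiring_1) matrix)"
  unfolding map_matrix_def mat_tensor_mk_matrix
  by (rule mk_matrix_cong) (auto elim!: set_prodE)

lemma iso_in_Mat_map_matrix: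
  assumes "finite I" "finite J" "\<And>i. i \<in> I \<Longrightarrow> h i \<in> J \<and> g (h i) = i" "\<And>j. j \<in> J \<Longrightarrow> g j \<in> I \<and> h (g j) = j"
  shows "iso_in (Mat :: (_, (_, 'k::field) matrix) hypergraph_structure) I J (map_matrix I J h)"
proof -
  have "mat_comp (map_matrix J I g) (map_matrix I J h) = (map_matrix I I (\<lambda>i. i) :: (_, 'k) matrix)"
    "mat_comp (map_matrix I J h) (map_matrix J I g) = (map_matrix J J (\<lambda>i. i) :: (_, 'k) matrix)"
    using assms by (simp_all add: mat_comp_map_map cong: map_matrix_cong)
  then show ?thesis
    unfolding iso_in_def Mat_def by (auto simp: map_matrix_def)
qed

section \<open>Functor laws and coherence\<close>

locale matrix_interpretation = interpretation_data \<Sigma> X T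
  for \<Sigma> :: "('o, 'm) signature" and X :: "'o \<Rightarrow> 'u elem set"
    and T :: "'m \<Rightarrow> 'u elem list \<Rightarrow> 'u elem list \<Rightarrow> 'k::field"
begin

definition ob :: "'o list \<Rightarrow> 'u elem set" where
  "ob w = tuple ` tuples X w"

text \<open>An arrow is a bare set of diagrams, so its domain and codomain words are recovered from
  the labels at the boundary of the chosen representative.\<close>

definition arr :: "('o, 'm) dot_arrow \<Rightarrow> ('u, 'k) matrix" where
  "arr f = (let H = (SOME H. H \<in> f) in
     mk_matrix (ob (map (\<lambda>i. DLab H (ThIn H (Inr i))) [0..<NIn H]))
       (ob (map (\<lambda>j. DLab H (ThOut H (Inr j))) [0..<NOut H]))
       (\<lambda>x y. state_sum H (untuple x) (untuple y)))"

text \<open>The comparison isomorphism on indices. It is not an identity: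
  \<open>tuple (xs @ ys)\<close> and \<open>Pr (tuple xs) (tuple ys)\<close> differ in bracketing
  and in the number of occurrences of \<open>Point\<close>.\<close>

definition split_tuple :: "nat \<Rightarrow> 'u elem \<Rightarrow> 'u elem" where
  "split_tuple n x = Pr (tuple (take n (untuple x))) (tuple (drop n (untuple x)))"

definition join_tuple :: "'u elem \<Rightarrow> 'u elem" where
  "join_tuple y = tuple (untuple (left y) @ untuple (right y))"

definition splitting :: "'o list \<Rightarrow> 'o list \<Rightarrow> ('u, 'k) matrix" where
  "splitting v w = map_matrix (ob (v @ w)) (set_prod (ob v) (ob w)) (split_tuple (length v))"

definition sem :: "('o list, ('o, 'm) dot_arrow, 'u elem set, ('u, 'k) matrix) functor_data" where
  "sem = \<lparr> OnOb = ob, OnArr = arr, PIso = splitting, UIso = map_matrix {Point} {Point} (\<lambda>x. x) \<rparr>"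

lemma finite_ob [simp]: "finite (ob w)"
  by (simp add: ob_def finite_tup)

lemma ob_Nil [simp]: "ob [] = {Point}"
  by (simp add: ob_def)

lemma tuple_in_ob [simp]: "tuple xs \<in> ob w \<longleftrightarrow> xs \<in> tuples X w"
  unfolding ob_def by (metis imageE imageI untuple_tuple)

lemma obE:
  assumes "x \<in> ob w"
  obtains xs where "x = tuple xs" "xs \<in> tuples X w"
  using assms by (auto simp: ob_def)

lemma ob_appendE:
  assumes "x \<in> ob (v @ w)"
  obtains xs ys where "x = tuple (xs @ ys)" "xs \<in> tuples X v" "ys \<in> tuples X w" "length xs = length v"
proof -
  obtain zs where zs: "x = tuple zs" "zs \<in> tuples X (v @ w)" using assms by (rule obE)
  then show thesis
    using that[of "take (length v) zs" "drop (length v) zs"]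
    by (simp add: take_in_tuples drop_in_tuples length_tuples)
qed

lemma split_tuple_append [simp]:
  "length xs = n \<Longrightarrow> split_tuple n (tuple (xs @ ys)) = Pr (tuple xs) (tuple ys)"
  by (simp add: split_tuple_def)

lemma join_tuple_Pr [simp]: "join_tuple (Pr (tuple xs) (tuple ys)) = tuple (xs @ ys)"
  by (simp add: join_tuple_def)

lemma split_tuple_in: "x \<in> ob (v @ w) \<Longrightarrow> split_tuple (length v) x \<in> set_prod (ob v) (ob w)"
  by (auto elim!: ob_appendE)

lemma split_join:
  "x \<in> ob (v @ w) \<Longrightarrow> join_tuple (split_tuple (length v) x) = x"
  "y \<in> set_prod (ob v) (ob w) \<Longrightarrow> join_tuple y \<in> ob (v @ w) \<and> split_tuple (length v) (join_tuple y) = y"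
  by (auto elim!: ob_appendE) (auto elim!: set_prodE obE simp: append_in_tuples length_tuples)

text \<open>All representatives share the state sums \<open>P\<close> on index words of the right
  type, so the choice inside \<open>arr\<close> is immaterial; other entries are normalised to
  0.\<close>

lemma arr_eq:
  assumes "denotes f v w P"
  shows "arr f = mk_matrix (ob v) (ob w) (\<lambda>x y. P (untuple x) (untuple y))"
proof -
  define H where "H = (SOME H. H \<in> f)"
  have "H \<in> f" using assms unfolding H_def denotes_def by (auto intro: someI)
  then have H: "has_boundary H v w" "\<And>xs ys. xs \<in> tuples X v \<Longrightarrow> ys \<in> tuples X w \<Longrightarrow> state_sum H xs ys = P xs ys"
    using assms unfolding denotes_def by blast+
  have "map (\<lambda>i. DLab H (ThIn H (Inr i))) [0..<NIn H] = v"
    "map (\<lambda>j. DLab H (ThOut H (Inr j))) [0..<NOut H] = w"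
    using H(1) by (auto simp: has_boundary_def intro: nth_equalityI)
  then show ?thesis
    unfolding arr_def H_def[symmetric] Let_def
    by (auto simp: H(2) elim!: obE intro!: mk_matrix_cong)
qed

lemma arr_map:
  assumes "denotes_map f v w h"
  shows "arr f = map_matrix (ob v) (ob w) (\<lambda>x. tuple (h (untuple x)))"
proof -
  have "arr f = mk_matrix (ob v) (ob w) (\<lambda>x y. of_bool (untuple y = h (untuple x)))"
    using assms by (intro arr_eq) (simp add: denotes_map_def)
  also have "\<dots> = map_matrix (ob v) (ob w) (\<lambda>x. tuple (h (untuple x)))"
    unfolding map_matrix_def by (rule mk_matrix_cong) (auto elim!: obE dest: arg_cong[where f = untuple])
  finally show ?thesis .
qed

lemma arr_id:
  assumes "w \<in> lists (SObj \<Sigma>)"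
  shows "arr (dot_id \<Sigma> w) = map_matrix (ob w) (ob w) (\<lambda>x. x)"
  unfolding arr_map[OF denotes_id(1)[OF assms]]
  by (rule map_matrix_cong) (auto elim!: obE)

lemma arr_comp:
  assumes "f \<in> dot_hom \<Sigma> v w" "g \<in> dot_hom \<Sigma> w u"
  shows "arr (dot_comp \<Sigma> g f) = mat_comp (arr g) (arr f)"
proof -
  obtain P Q where *: "denotes f v w P" "denotes g w u Q"
    using assms by (metis denotes_hom)
  have "(\<Sum>j \<in> ob w. P xs (untuple j) * Q (untuple j) zs) = (\<Sum>ys \<in> tuples X w. P xs ys * Q ys zs)" for xs zs
    unfolding ob_def by (subst sum.reindex) (auto intro: inj_on_inverseI[of _ untuple])
  then show ?thesis
    by (simp add: arr_eq[OF denotes_comp[OF *]] arr_eq[OF *(1)] arr_eq[OF *(2)] mat_comp_mk_matrix)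
qed

lemma splitting_natural:
  assumes "f \<in> dot_hom \<Sigma> v v'" "g \<in> dot_hom \<Sigma> w w'"
  shows "mat_comp (splitting v' w') (arr (dot_tensor \<Sigma> f g)) =
    mat_comp (mat_tensor (arr f) (arr g)) (splitting v w)"
proof -
  obtain P Q where *: "denotes f v v' P" "denotes g w w' Q"
    using assms by (metis denotes_hom)
  show ?thesis
    unfolding arr_eq[OF denotes_tensor[OF *]] arr_eq[OF *(1)] arr_eq[OF *(2)] mat_tensor_mk_matrix splitting_def
    \<comment> \<open>The left side joins the codomain index, the right side splits the domain
      index; on coded words both give the same product of entries.\<close>
    by (subst mat_comp_map_left[where g = join_tuple], simp_all add: split_join mat_comp_map_right split_tuple_in)
      (rule mk_matrix_cong, auto elim!: set_prodE obE simp: length_tuples split_tuple_def)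
qed

text \<open>The associator of \<open>Dot\<close> is an identity, so both sides are matrices of maps
  on codes of \<open>xs @ ys @ zs\<close>. It remains to see that both produce the same nested
  pair.\<close>

lemma splitting_assoc:
  assumes "u \<in> lists (SObj \<Sigma>)" "v \<in> lists (SObj \<Sigma>)" "w \<in> lists (SObj \<Sigma>)"
  shows "mat_comp (Assoc Mat (ob u) (ob v) (ob w))
      (mat_comp (mat_tensor (splitting u v) (map_matrix (ob w) (ob w) (\<lambda>x. x))) (splitting (u @ v) w)) =
    mat_comp (mat_tensor (map_matrix (ob u) (ob u) (\<lambda>x. x)) (splitting v w))
      (mat_comp (splitting u (v @ w)) (arr (dot_id \<Sigma> (u @ v @ w))))"
proof -
  have triple: "\<exists>xs ys zs. x = tuple (xs @ ys @ zs) \<and> xs \<in> tuples X u \<and> ys \<in> tuples X v \<and> zs \<in> tuples X w \<and>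
      length xs = length u \<and> length ys = length v" if x: "x \<in> ob (u @ v @ w)" for x
  proof -
    obtain xs r where "x = tuple (xs @ r)" "xs \<in> tuples X u" "r \<in> tuples X (v @ w)"
      using x by (rule ob_appendE)
    then show ?thesis
      by (intro exI[of _ xs] exI[of _ "take (length v) r"] exI[of _ "drop (length v) r"])
        (simp add: take_in_tuples drop_in_tuples length_tuples)
  qed
  have l: "mat_comp (mat_tensor (splitting u v) (map_matrix (ob w) (ob w) (\<lambda>x. x))) (splitting (u @ v) w)
     = map_matrix (ob (u @ v @ w)) (set_prod (set_prod (ob u) (ob v)) (ob w))
         (\<lambda>x. Pr (split_tuple (length u) (left (split_tuple (length u + length v) x)))
               (right (split_tuple (length u + length v) x)))"
    unfolding splitting_def mat_tensor_map_map
    by (subst mat_comp_map_map) (use split_tuple_in[of _ "u @ v" w] in auto)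
  have r: "mat_comp (splitting u (v @ w)) (arr (dot_id \<Sigma> (u @ v @ w))) = splitting u (v @ w)"
    using assms by (simp add: arr_id splitting_def mat_comp_map_map)
  have r': "mat_comp (mat_tensor (map_matrix (ob u) (ob u) (\<lambda>x. x)) (splitting v w)) (splitting u (v @ w))
     = map_matrix (ob (u @ v @ w)) (set_prod (ob u) (set_prod (ob v) (ob w)))
         (\<lambda>x. Pr (left (split_tuple (length u) x)) (split_tuple (length v) (right (split_tuple (length u) x))))"
    unfolding splitting_def mat_tensor_map_map
    by (subst mat_comp_map_map) (use split_tuple_in[of _ u "v @ w"] in auto)
  show ?thesis
    unfolding l r r' Mat_def hypergraph_structure.simps
    by (subst mat_comp_map_map)
      (auto dest!: triple simp: split_tuple_def intro!: map_matrix_cong)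
qed

lemma hypergraph_functor_sem: "hypergraph_functor (Dot \<Sigma>) Mat sem"
proof unfold_locales
  note [simp] = sem_def Dot_def Mat_def
  \<comment> \<open>\<open>iso_in_Mat_map_matrix\<close> is about \<open>Mat\<close> as a whole;
    these two fields allow it to be applied without unfolding \<open>Mat\<close>.\<close>
  have Mat_fields: "TensorO Mat = set_prod" "UnitO Mat = {Point}"
    by simp_all
  show "OnOb sem A \<in> Ob Mat" if "A \<in> Ob (Dot \<Sigma>)" for A
    by simp
  show "OnArr sem f \<in> Hom Mat (OnOb sem A) (OnOb sem B)"
    if f: "f \<in> Hom (Dot \<Sigma>) A B" for A B f
  proof -
    have "f \<in> dot_hom \<Sigma> A B" using f by simp
    then obtain P where "denotes f A B P" by (rule denotes_hom)
    then show ?thesis by (simp add: arr_eq)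
  qed
  show "OnArr sem (Id (Dot \<Sigma>) A) = Id Mat (OnOb sem A)" if "A \<in> Ob (Dot \<Sigma>)" for A
    using that by (simp add: arr_id)
  show "OnArr sem (Comp (Dot \<Sigma>) g f) = Comp Mat (OnArr sem g) (OnArr sem f)"
    if "A \<in> Ob (Dot \<Sigma>)" "B \<in> Ob (Dot \<Sigma>)" "C \<in> Ob (Dot \<Sigma>)"
      "f \<in> Hom (Dot \<Sigma>) A B" "g \<in> Hom (Dot \<Sigma>) B C" for A B C f g
    using that by (simp add: arr_comp)
  show "iso_in Mat (OnOb sem (TensorO (Dot \<Sigma>) A B)) (TensorO Mat (OnOb sem A) (OnOb sem B)) (PIso sem A B)"
    if "A \<in> Ob (Dot \<Sigma>)" "B \<in> Ob (Dot \<Sigma>)" for A B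
    using iso_in_Mat_map_matrix[where h = "split_tuple (length A)" and g = join_tuple
        and I = "ob (A @ B)" and J = "set_prod (ob A) (ob B)"]
    by (simp add: splitting_def split_tuple_in split_join Mat_fields del: Mat_def)
  show "iso_in Mat (OnOb sem (UnitO (Dot \<Sigma>))) (UnitO Mat) (UIso sem)"
    using iso_in_Mat_map_matrix[where h = "\<lambda>x. x" and g = "\<lambda>x. x" and I = "{Point}" and J = "{Point}"]
    by (simp add: Mat_fields del: Mat_def)
  show "Comp Mat (PIso sem A' B') (OnArr sem (Tensor (Dot \<Sigma>) f g)) =
      Comp Mat (Tensor Mat (OnArr sem f) (OnArr sem g)) (PIso sem A B)"
    if "f \<in> Hom (Dot \<Sigma>) A A'" "g \<in> Hom (Dot \<Sigma>) B B'" for A A' B B' f g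
    using that by (simp add: splitting_natural)
  show "Comp Mat (Assoc Mat (OnOb sem A) (OnOb sem B) (OnOb sem C))
      (Comp Mat (Tensor Mat (PIso sem A B) (Id Mat (OnOb sem C))) (PIso sem (TensorO (Dot \<Sigma>) A B) C)) =
    Comp Mat (Tensor Mat (Id Mat (OnOb sem A)) (PIso sem B C))
      (Comp Mat (PIso sem A (TensorO (Dot \<Sigma>) B C)) (OnArr sem (Assoc (Dot \<Sigma>) A B C)))"
    if "A \<in> Ob (Dot \<Sigma>)" "B \<in> Ob (Dot \<Sigma>)" "C \<in> Ob (Dot \<Sigma>)" for A B C
    using splitting_assoc[of A B C] that by simp
  show "OnArr sem (LUnit (Dot \<Sigma>) A) =
    Comp Mat (LUnit Mat (OnOb sem A))
      (Comp Mat (Tensor Mat (UIso sem) (Id Mat (OnOb sem A))) (PIso sem (UnitO (Dot \<Sigma>)) A))"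
    if "A \<in> Ob (Dot \<Sigma>)" for A
  proof -
    have split: "split_tuple 0 x = Pr Point x" if "x \<in> ob A" for x
      using that by (auto simp: split_tuple_def elim: obE)
    \<comment> \<open>The unitor of \<open>Dot\<close> is an identity; splitting off the empty word
      creates a \<open>Point\<close>, which \<open>right\<close> discards again.\<close>
    have "mat_comp (map_matrix (set_prod {Point} (ob A)) (ob A) right)
        (mat_comp (mat_tensor (map_matrix {Point} {Point} (\<lambda>x. x)) (map_matrix (ob A) (ob A) (\<lambda>x. x)))
          (splitting [] A)) = (map_matrix (ob A) (ob A) (\<lambda>x. x) :: (_, 'k) matrix)"
      unfolding splitting_def mat_tensor_map_map ob_Nil append_Nil append_Nil2 list.size
      by (simp add: mat_comp_map_map split cong: map_matrix_cong)
    then show ?thesis using that by (simp add: arr_id)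
  qed
  show "OnArr sem (RUnit (Dot \<Sigma>) A) =
    Comp Mat (RUnit Mat (OnOb sem A))
      (Comp Mat (Tensor Mat (Id Mat (OnOb sem A)) (UIso sem)) (PIso sem A (UnitO (Dot \<Sigma>))))"
    if "A \<in> Ob (Dot \<Sigma>)" for A
  proof -
    have split: "split_tuple (length A) x = Pr x Point" if "x \<in> ob A" for x
      using that by (auto simp: split_tuple_def length_tuples elim!: obE)
    have "mat_comp (map_matrix (set_prod (ob A) {Point}) (ob A) left)
        (mat_comp (mat_tensor (map_matrix (ob A) (ob A) (\<lambda>x. x)) (map_matrix {Point} {Point} (\<lambda>x. x)))
          (splitting A [])) = (map_matrix (ob A) (ob A) (\<lambda>x. x) :: (_, 'k) matrix)"
      unfolding splitting_def mat_tensor_map_map ob_Nil append_Nil append_Nil2 list.size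
      by (simp add: mat_comp_map_map split cong: map_matrix_cong)
    then show ?thesis using that by (simp add: arr_id)
  qed
  show "Comp Mat (PIso sem B A) (OnArr sem (Sym (Dot \<Sigma>) A B)) =
      Comp Mat (Sym Mat (OnOb sem A) (OnOb sem B)) (PIso sem A B)"
    if "A \<in> Ob (Dot \<Sigma>)" "B \<in> Ob (Dot \<Sigma>)" for A B
  proof -
    have arr: "arr (dot_swap \<Sigma> A B) = map_matrix (ob (A @ B)) (ob (B @ A))
        (\<lambda>x. tuple (drop (length A) (untuple x) @ take (length A) (untuple x)))"
      using that by (simp add: arr_map[OF denotes_swap(1)])
    have "mat_comp (splitting B A) (arr (dot_swap \<Sigma> A B)) =
      mat_comp (map_matrix (set_prod (ob A) (ob B)) (set_prod (ob B) (ob A)) (\<lambda>x. Pr (right x) (left x)))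
        (splitting A B)"
      unfolding arr splitting_def
      by (subst (1 2) mat_comp_map_map)
        (auto simp: split_tuple_in length_tuples elim!: ob_appendE intro!: append_in_tuples map_matrix_cong)
    then show ?thesis by simp
  qed
  show "OnArr sem (Mu (Dot \<Sigma>) A) = Comp Mat (Mu Mat (OnOb sem A)) (PIso sem A A)"
    if "A \<in> Ob (Dot \<Sigma>)" for A
  proof -
    have "arr (dot_mu \<Sigma> A) = mk_matrix (ob (A @ A)) (ob A) (\<lambda>x y. of_bool (untuple x = untuple y @ untuple y))"
      using that denotes_mu[of A] by (intro arr_eq) (simp add: denotes_comap_def)
    also have "\<dots> = mat_comp
        (mk_matrix (set_prod (ob A) (ob A)) (ob A) (\<lambda>x k. if left x = k \<and> right x = k then 1 else 0)) (splitting A A)"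
      unfolding splitting_def
      by (subst mat_comp_map_right, simp_all add: split_tuple_in)
        (rule mk_matrix_cong, erule ob_appendE, erule obE, simp add: length_tuples)
    finally show ?thesis by simp
  qed
  show "OnArr sem (Eta (Dot \<Sigma>) A) = Comp Mat (Eta Mat (OnOb sem A)) (UIso sem)"
    if "A \<in> Ob (Dot \<Sigma>)" for A
    using that arr_eq[OF denotes_eta[of A]]
      mat_comp_map_right[of "{Point}" "{Point}" "\<lambda>x. x" "ob A" "\<lambda>_ _. 1 :: 'k"]
    by simp
  show "Comp Mat (PIso sem A A) (OnArr sem (Delta (Dot \<Sigma>) A)) = Delta Mat (OnOb sem A)"
    if "A \<in> Ob (Dot \<Sigma>)" for A
  proof -
    have "arr (dot_delta \<Sigma> A) = mk_matrix (ob A) (ob (A @ A)) (\<lambda>x y. of_bool (untuple y = untuple x @ untuple x))"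
      using that denotes_delta[of A] by (intro arr_eq) (simp add: denotes_map_def)
    then have "mat_comp (splitting A A) (arr (dot_delta \<Sigma> A)) =
        mk_matrix (ob A) (set_prod (ob A) (ob A)) (\<lambda>i y. if i = left y \<and> i = right y then 1 else 0)"
      unfolding splitting_def
      by (simp add: mat_comp_map_left[where g = join_tuple] split_join)
        (rule mk_matrix_cong, auto simp: length_tuples elim!: set_prodE obE)
    then show ?thesis by simp
  qed
  show "Comp Mat (UIso sem) (OnArr sem (Epsilon (Dot \<Sigma>) A)) = Epsilon Mat (OnOb sem A)"
    if "A \<in> Ob (Dot \<Sigma>)" for A
    using that arr_eq[OF denotes_epsilon[of A]]
      mat_comp_map_left[of "{Point}" "\<lambda>x. x" "\<lambda>x. x" "{Point}" "ob A" "\<lambda>_ _. 1 :: 'k"]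
    by simp
qed

end

section \<open>Counting homomorphisms\<close>

text \<open>Extensional maps count each homomorphism once. The dot map comes first because box maps
  will be counted over a fixed dot map.\<close>

definition homs ::
  "('o, 'm) signature \<Rightarrow> ('o, 'm, 'b, 'd) dot_diagram \<Rightarrow> ('o, 'm, 'b2, 'd2) dot_diagram
    \<Rightarrow> (('d \<Rightarrow> 'd2) \<times> ('b \<Rightarrow> 'b2)) set" where
  "homs \<Sigma> F H = {(q, p). q \<in> (Dots F \<rightarrow>\<^sub>E Dots H) \<and> p \<in> (Boxes F \<rightarrow>\<^sub>E Boxes H) \<and> dd_homomorphism \<Sigma> F H p q}"

definition hom_image ::
  "('o, 'm, 'b, 'd) dot_diagram \<Rightarrow> ('d \<Rightarrow> 'd2) \<times> ('b \<Rightarrow> 'b2) \<Rightarrow> 'd2 set \<times> 'b2 set" where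
  "hom_image F = (\<lambda>(q, p). (q ` Dots F, p ` Boxes F))"

definition surjections ::
  "('o, 'm) signature \<Rightarrow> ('o, 'm, 'b, 'd) dot_diagram \<Rightarrow> ('o, 'm, 'b2, 'd2) dot_diagram
    \<Rightarrow> (('d \<Rightarrow> 'd2) \<times> ('b \<Rightarrow> 'b2)) set" where
  "surjections \<Sigma> F H = {\<phi> \<in> homs \<Sigma> F H. hom_image F \<phi> = (Dots H, Boxes H)}"

lemma finite_homs:
  assumes "is_dot_diagram \<Sigma> F" "is_dot_diagram \<Sigma> H"
  shows "finite (homs \<Sigma> F H)"
proof (rule finite_subset)
  show "homs \<Sigma> F H \<subseteq> (Dots F \<rightarrow>\<^sub>E Dots H) \<times> (Boxes F \<rightarrow>\<^sub>E Boxes H)"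
    by (auto simp: homs_def)
  show "finite ((Dots F \<rightarrow>\<^sub>E Dots H) \<times> (Boxes F \<rightarrow>\<^sub>E Boxes H))"
    using assms by (intro finite_cartesian_product finite_PiE) (auto simp: is_dot_diagram_iff)
qed

section \<open>Sorting homomorphisms by their image\<close>

definition subdiagram ::
  "('o, 'm, 'b, 'd) dot_diagram \<Rightarrow> 'd set \<Rightarrow> 'b set \<Rightarrow> ('o, 'm, 'b, 'd) dot_diagram" where
  "subdiagram H D S = H\<lparr>Boxes := S, Dots := D\<rparr>"

lemma subdiagram_simps [simp]:
  "Boxes (subdiagram H D S) = S" "Dots (subdiagram H D S) = D"
  "NIn (subdiagram H D S) = NIn H" "NOut (subdiagram H D S) = NOut H"
  "BLab (subdiagram H D S) = BLab H" "DLab (subdiagram H D S) = DLab H"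
  "ThIn (subdiagram H D S) = ThIn H" "ThOut (subdiagram H D S) = ThOut H"
  by (simp_all add: subdiagram_def)

text \<open>Labels and wiring are shared, so the same pairs of maps qualify on both sides. This
  holds even if \<open>D\<close> misses a dot wired to \<open>S\<close>, so that the restriction is
  no diagram.\<close>

lemma surjections_subdiagram:
  assumes "D \<subseteq> Dots H" "S \<subseteq> Boxes H"
  shows "surjections \<Sigma> F (subdiagram H D S) = {\<phi> \<in> homs \<Sigma> F H. hom_image F \<phi> = (D, S)}"
  using assms
  by (auto simp: surjections_def homs_def hom_image_def dd_homomorphism_iff PiE_iff)

text \<open>Whatever a box in the image or the boundary of \<open>H\<close> is wired to is the image
  of the corresponding dot of \<open>F\<close>, so images are closed under the wiring.\<close>

lemma is_dot_diagram_image: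
  assumes F: "is_dot_diagram \<Sigma> F" and H: "is_dot_diagram \<Sigma> H"
    and \<phi>: "\<phi> \<in> homs \<Sigma> F H" "hom_image F \<phi> = (D, S)"
  shows "is_dot_diagram \<Sigma> (subdiagram H D S)"
proof -
  obtain p q where hom: "dd_homomorphism \<Sigma> F H p q" and DS: "D = q ` Dots F" "S = p ` Boxes F"
    using \<phi> by (auto simp: homs_def hom_image_def)
  have "D \<subseteq> Dots H" "S \<subseteq> Boxes H"
    using dd_homomorphism_maps[OF hom] DS by auto
  moreover have "ThIn H (Inl (b, i)) \<in> D" if "b \<in> S" "i < length (SDom \<Sigma> (BLab H b))" for b i
    using hom F that unfolding DS dd_homomorphism_iff is_dot_diagram_iff by auto
  moreover have "ThOut H (Inl (i, b)) \<in> D" if "b \<in> S" "i < length (SCod \<Sigma> (BLab H b))" for b i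
    using hom F that unfolding DS dd_homomorphism_iff is_dot_diagram_iff by auto
  moreover have "ThIn H (Inr i) \<in> D" if "i < NIn H" for i
    using hom F that unfolding DS dd_homomorphism_iff is_dot_diagram_iff by auto
  moreover have "ThOut H (Inr i) \<in> D" if "i < NOut H" for i
    using hom F that unfolding DS dd_homomorphism_iff is_dot_diagram_iff by auto
  ultimately show ?thesis
    using H unfolding is_dot_diagram_iff subdiagram_simps
    by (meson finite_subset subsetD)
qed

text \<open>Each homomorphism is counted under its image. The sum may range over all pairs of
  subsets, since pairs that form no diagram are never images and contribute 0.\<close>

lemma card_homs_image:
  assumes "is_dot_diagram \<Sigma> F" "is_dot_diagram \<Sigma> H"
  shows "card (homs \<Sigma> F H) =
    (\<Sum>(D, S) \<in> Pow (Dots H) \<times> Pow (Boxes H). card (surjections \<Sigma> F (subdiagram H D S)))"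
proof -
  have fin: "finite (Pow (Dots H) \<times> Pow (Boxes H))"
    using assms(2) by (auto simp: is_dot_diagram_iff)
  have "card (homs \<Sigma> F H) =
      (\<Sum>P \<in> Pow (Dots H) \<times> Pow (Boxes H). \<Sum>\<phi> \<in> {\<phi> \<in> homs \<Sigma> F H. hom_image F \<phi> = P}. 1)"
    by (subst sum.group[OF finite_homs[OF assms] fin])
      (auto simp: homs_def hom_image_def PiE_iff)
  also have "\<dots> = (\<Sum>(D, S) \<in> Pow (Dots H) \<times> Pow (Boxes H). card (surjections \<Sigma> F (subdiagram H D S)))"
    by (rule sum.cong) (auto simp: surjections_subdiagram)
  finally show ?thesis .
qed

text \<open>Inversion of a triangular system: the full pair occurs once in the sum over images and
  all other pairs are smaller, so their equal contributions cancel. Subdiagrams keep the types of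
  \<open>H\<close>, so the induction stays within the diagrams covered by \<open>eq\<close>.\<close>

lemma card_surjections_eq:
  fixes H :: "('o, 'm, 'b, 'd) dot_diagram"
  assumes F: "is_dot_diagram \<Sigma> F" and G: "is_dot_diagram \<Sigma> G"
    and eq: "\<And>H :: ('o, 'm, 'b, 'd) dot_diagram. is_dot_diagram \<Sigma> H \<Longrightarrow> has_boundary H v w \<Longrightarrow>
      card (homs \<Sigma> F H) = card (homs \<Sigma> G H)"
  shows "is_dot_diagram \<Sigma> H \<Longrightarrow> has_boundary H v w \<Longrightarrow>
    card (surjections \<Sigma> F H) = card (surjections \<Sigma> G H)"
proof (induction "card (Dots H) + card (Boxes H)" arbitrary: H rule: less_induct)
  case less
  let ?P = "Pow (Dots H) \<times> Pow (Boxes H)"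
  let ?top = "(Dots H, Boxes H)"
  have H: "finite (Dots H)" "finite (Boxes H)"
    using less.prems(1) by (simp_all add: is_dot_diagram_iff)
  let ?f = "\<lambda>F (D, S). card (surjections \<Sigma> F (subdiagram H D S))"
  have "?f F (D, S) = ?f G (D, S)" if P: "(D, S) \<in> ?P - {?top}" for D S
  proof (cases "is_dot_diagram \<Sigma> (subdiagram H D S)")
    case True
    \<comment> \<open>Any pair other than the full one is proper in at least one component, so the
      measure drops.\<close>
    have "D \<subset> Dots H \<and> S \<subseteq> Boxes H \<or> D \<subseteq> Dots H \<and> S \<subset> Boxes H" using P by auto
    then have "card D + card S < card (Dots H) + card (Boxes H)"
      using H by (auto intro: add_less_le_mono add_le_less_mono psubset_card_mono card_mono)
    moreover have "has_boundary (subdiagram H D S) v w"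
      using less.prems(2) by (simp add: has_boundary_def)
    ultimately show ?thesis using less.hyps[of "subdiagram H D S"] True by simp
  next
    case False
    have "surjections \<Sigma> F (subdiagram H D S) = {}" "surjections \<Sigma> G (subdiagram H D S) = {}"
      using P False is_dot_diagram_image[OF F less.prems(1)] is_dot_diagram_image[OF G less.prems(1)]
      by (auto simp: surjections_subdiagram)
    then show ?thesis by simp
  qed
  then have "sum (?f F) (?P - {?top}) = sum (?f G) (?P - {?top})"
    by (intro sum.cong) auto
  moreover have "sum (?f F) ?P = sum (?f G) ?P"
    using eq[OF less.prems] by (simp only: card_homs_image[OF F less.prems(1)] card_homs_image[OF G less.prems(1)])
  ultimately have "?f F ?top = ?f G ?top"
    using H sum.remove[of ?P ?top "?f F"] sum.remove[of ?P ?top "?f G"] by simp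
  then show ?case by (simp add: subdiagram_def)
qed

text \<open>Surjections both ways between finite sets force equal cardinalities, hence the forward
  maps are injective. The backward homomorphism need not be their inverse.\<close>

lemma surjections_mutual_isomorphic:
  assumes F: "is_dot_diagram \<Sigma> F" and G: "is_dot_diagram \<Sigma> G"
    and "surjections \<Sigma> F G \<noteq> {}" "surjections \<Sigma> G F \<noteq> {}"
  shows "dd_isomorphic \<Sigma> F G"
proof -
  have fin: "finite (Dots F)" "finite (Dots G)" "finite (Boxes F)" "finite (Boxes G)"
    using F G by (simp_all add: is_dot_diagram_iff)
  obtain p q where hom: "dd_homomorphism \<Sigma> F G p q" and im: "q ` Dots F = Dots G" "p ` Boxes F = Boxes G"
    using assms(3) by (auto simp: surjections_def homs_def hom_image_def)
  obtain p' q' where im': "q' ` Dots G = Dots F" "p' ` Boxes G = Boxes F"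
    using assms(4) by (auto simp: surjections_def homs_def hom_image_def)
  have "card (Dots F) \<le> card (Dots G)" "card (Boxes F) \<le> card (Boxes G)"
    using card_image_le[OF fin(2), of q'] card_image_le[OF fin(4), of p'] im' by simp_all
  moreover have "card (Dots G) \<le> card (Dots F)" "card (Boxes G) \<le> card (Boxes F)"
    using card_image_le[OF fin(1), of q] card_image_le[OF fin(3), of p] im by simp_all
  ultimately have "inj_on q (Dots F)" "inj_on p (Boxes F)"
    using im fin by (auto intro: eq_card_imp_inj_on)
  then show ?thesis
    using im by (intro dd_isomorphicI[OF F hom]) (auto simp: bij_betw_def)
qed

lemma isomorphic_if_card_homs_eq:
  fixes F G :: "('o, 'm, 'b, 'd) dot_diagram"
  assumes F: "is_dot_diagram \<Sigma> F" "has_boundary F v w" and G: "is_dot_diagram \<Sigma> G" "has_boundary G v w"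
    and eq: "\<And>H :: ('o, 'm, 'b, 'd) dot_diagram. is_dot_diagram \<Sigma> H \<Longrightarrow> has_boundary H v w \<Longrightarrow>
      card (homs \<Sigma> F H) = card (homs \<Sigma> G H)"
  shows "dd_isomorphic \<Sigma> F G"
proof (rule surjections_mutual_isomorphic[OF F(1) G(1)])
  \<comment> \<open>The identity is onto, which keeps the counts nonzero when \<open>H\<close> is
    taken to be \<open>F\<close> or \<open>G\<close>.\<close>
  have self: "card (surjections \<Sigma> H H) \<noteq> 0" if "is_dot_diagram \<Sigma> H" for H :: "('o, 'm, 'b, 'd) dot_diagram"
  proof -
    have "(restrict id (Dots H), restrict id (Boxes H)) \<in> surjections \<Sigma> H H"
      using that by (auto simp: surjections_def homs_def hom_image_def dd_homomorphism_iff is_dot_diagram_iff)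
    moreover have "finite (surjections \<Sigma> H H)"
      using finite_homs[OF that that] by (simp add: surjections_def)
    ultimately show ?thesis by auto
  qed
  show "surjections \<Sigma> F G \<noteq> {}" "surjections \<Sigma> G F \<noteq> {}"
    using card_surjections_eq[OF F(1) G(1) eq G] card_surjections_eq[OF F(1) G(1) eq F]
      self[OF F(1)] self[OF G(1)] by auto
qed

section \<open>The interpretation given by a diagram\<close>

text \<open>Nothing is assumed about the type of atoms, so infinitely many elements are built from
  constructors alone.\<close>

definition nat_elem :: "nat \<Rightarrow> 'u elem" where
  "nat_elem n = tuple (replicate n Point)"

lemma nat_elem_eq_iff [simp]: "nat_elem m = nat_elem n \<longleftrightarrow> m = n"
  by (auto simp: nat_elem_def dest: arg_cong[where f = length])

definition dots_of :: "('o, 'm, 'b, nat) dot_diagram \<Rightarrow> 'o \<Rightarrow> 'u elem set" where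
  "dots_of H A = nat_elem ` {d \<in> Dots H. DLab H d = A}"

text \<open>Its cardinality will be the matrix entry of \<open>f\<close>. A mere 0-1 entry would
  lose information: several boxes of \<open>H\<close> may share label and wiring, and each is a
  separate possible image.\<close>

definition boxes_of ::
  "('o, 'm) signature \<Rightarrow> ('o, 'm, 'b, nat) dot_diagram \<Rightarrow> 'm \<Rightarrow> 'u elem list \<Rightarrow> 'u elem list \<Rightarrow> 'b set" where
  "boxes_of \<Sigma> H f xs ys = {b \<in> Boxes H. BLab H b = f \<and>
     map (\<lambda>i. nat_elem (ThIn H (Inl (b, i)))) [0..<length (SDom \<Sigma> f)] = xs \<and>
     map (\<lambda>j. nat_elem (ThOut H (Inl (j, b)))) [0..<length (SCod \<Sigma> f)] = ys}"

definition in_tuple :: "('o, 'm, 'b, nat) dot_diagram \<Rightarrow> 'u elem list" where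
  "in_tuple H = map (\<lambda>i. nat_elem (ThIn H (Inr i))) [0..<NIn H]"

definition out_tuple :: "('o, 'm, 'b, nat) dot_diagram \<Rightarrow> 'u elem list" where
  "out_tuple H = map (\<lambda>j. nat_elem (ThOut H (Inr j))) [0..<NOut H]"

lemma boundary_tuples:
  assumes "is_dot_diagram \<Sigma> H" "has_boundary H v w"
  shows "in_tuple H \<in> tuples (dots_of H) v" "out_tuple H \<in> tuples (dots_of H) w"
  using assms by (auto simp: in_tuple_def out_tuple_def dots_of_def tuples_iff_nth has_boundary_def is_dot_diagram_iff)

text \<open>The \<open>itself\<close> arguments pin down the field and the type of atoms, neither of
  which occurs in \<open>\<Sigma>\<close> or \<open>H\<close>.\<close>

locale diagram_interpretation =
  fixes \<Sigma> :: "('o, 'm) signature" and H :: "('o, 'm, 'b, nat) dot_diagram" and field :: "'k::field itself"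
    and atoms :: "'u itself"
  assumes H: "is_dot_diagram \<Sigma> H"
begin

sublocale matrix_interpretation \<Sigma> "dots_of H :: 'o \<Rightarrow> 'u elem set"
  "\<lambda>f xs ys. of_nat (card (boxes_of \<Sigma> H f xs ys)) :: 'k"
  using H by unfold_locales (simp add: dots_of_def is_dot_diagram_iff)

text \<open>
  An assignment of indices is a map of dots, and its weight counts the maps of boxes completing
  it to a homomorphism.
\<close>

lemma state_sum_eq_card_homs:
  fixes F :: "('o, 'm, 'b2, 'd2) dot_diagram"
  assumes F: "is_dot_diagram \<Sigma> F" and bF: "has_boundary F v w" and bH: "has_boundary H v w"
  shows "state_sum F (in_tuple H) (out_tuple H) = of_nat (card (homs \<Sigma> F H))"
proof -
  have n: "NIn F = NIn H" "NOut F = NOut H" using bF bH by (simp_all add: has_boundary_def)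
  have wire: "\<And>i. i < NIn H \<Longrightarrow> ThIn F (Inr i) \<in> Dots F" "\<And>j. j < NOut H \<Longrightarrow> ThOut F (Inr j) \<in> Dots F"
    using F n by (simp_all add: is_dot_diagram_iff)
  define Q where "Q = {q \<in> Dots F \<rightarrow>\<^sub>E Dots H. (\<forall>d \<in> Dots F. DLab H (q d) = DLab F d) \<and>
      (\<forall>i < NIn H. ThIn H (Inr i) = q (ThIn F (Inr i))) \<and> (\<forall>j < NOut H. ThOut H (Inr j) = q (ThOut F (Inr j)))}"
  \<comment> \<open>The admissible images of the box \<open>b\<close> once the dot map
    \<open>q\<close> is fixed. They are chosen independently for different boxes, so the box maps
    over \<open>q\<close> form a product set.\<close>
  define C where "C q b = {b' \<in> Boxes H. BLab H b' = BLab F b \<and>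
      (\<forall>i < length (SDom \<Sigma> (BLab F b)). ThIn H (Inl (b', i)) = q (ThIn F (Inl (b, i)))) \<and>
      (\<forall>j < length (SCod \<Sigma> (BLab F b)). ThOut H (Inl (j, b')) = q (ThOut F (Inl (j, b))))}" for q b
  have fin: "finite Q" "finite (Boxes F)" "finite (C q b)" for q b
    using F H by (auto simp: Q_def C_def is_dot_diagram_iff intro: finite_subset[OF _ finite_PiE[of "Dots F" "\<lambda>_. Dots H"]])
  have homs: "homs \<Sigma> F H = (SIGMA q : Q. PiE (Boxes F) (C q))"
    using n by (auto simp: homs_def Q_def C_def dd_homomorphism_iff PiE_iff extensional_def)
  have "card (homs \<Sigma> F H) = (\<Sum>q \<in> Q. \<Prod>b \<in> Boxes F. card (C q b))"
    unfolding homs using fin by (subst card_SigmaI) (auto simp: card_PiE intro: finite_PiE)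
  then have "of_nat (card (homs \<Sigma> F H)) = (\<Sum>q \<in> Q. \<Prod>b \<in> Boxes F. of_nat (card (C q b)) :: 'k)"
    by simp
  also have "\<dots> = state_sum F (in_tuple H) (out_tuple H)"
    unfolding state_sum_def
  proof (rule sum.reindex_bij_witness[where
        j = "\<lambda>q. restrict (\<lambda>d. nat_elem (q d)) (Dots F)" and
        i = "\<lambda>l. restrict (\<lambda>d. inv nat_elem (l d)) (Dots F)"], goal_cases)
    have inj: "inj (nat_elem :: nat \<Rightarrow> 'u elem)" by (rule injI) simp
    {
      case (1 q)
      then have "restrict q (Dots F) = q" by (auto simp: Q_def PiE_iff extensional_restrict)
      then show ?case using inj by (simp cong: restrict_cong)
    next
      case (2 q)
      then show ?case
        using wire by (auto simp: states_iff n Q_def dots_of_def in_tuple_def out_tuple_def)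
    next
      case (3 l)
      have "nat_elem (inv nat_elem (l d)) = l d" if "d \<in> Dots F" for d
        using 3 that by (auto simp: states_iff dots_of_def intro!: f_inv_into_f)
      then show ?case using states_restrict[OF 3] by (simp cong: restrict_cong)
    next
      case (4 l)
      have *: "inv nat_elem (l d) \<in> Dots H \<and> DLab H (inv nat_elem (l d)) = DLab F d" if "d \<in> Dots F" for d
        using 4 that inj by (auto simp: states_iff dots_of_def)
      have "inv nat_elem (l (ThIn F (Inr i))) = ThIn H (Inr i)" if "i < NIn H" for i
        using 4 that inj by (simp add: states_iff n in_tuple_def)
      moreover have "inv nat_elem (l (ThOut F (Inr i))) = ThOut H (Inr i)" if "i < NOut H" for i
        using 4 that inj by (simp add: states_iff n out_tuple_def)
      ultimately show ?case using * wire by (simp add: Q_def)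
    next
      case (5 q)
      \<comment> \<open>The entry of a generator at the indices around \<open>b\<close> counts
        exactly the admissible images of \<open>b\<close>.\<close>
      have "boxes_of \<Sigma> H (BLab F b)
          (map (\<lambda>i. nat_elem (q (ThIn F (Inl (b, i)))) :: 'u elem) [0..<length (SDom \<Sigma> (BLab F b))])
          (map (\<lambda>j. nat_elem (q (ThOut F (Inl (j, b))))) [0..<length (SCod \<Sigma> (BLab F b))]) = C q b" for b
        by (auto simp: boxes_of_def C_def)
      then show ?case by (simp add: weight_restrict[OF F]) (simp add: weight_def)
    }
  qed
  finally show ?thesis by simp
qed

end

theorem corollary6p3:
  fixes \<Sigma> :: "('o, 'm) signature"
    and A B :: "'o list"
    and F G :: "('o, 'm) dot_arrow"
  assumes "monoidal_signature \<Sigma>"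
    and "A \<in> Ob (Dot \<Sigma>)" and "B \<in> Ob (Dot \<Sigma>)"
    and "F \<in> Hom (Dot \<Sigma>) A B" and "G \<in> Hom (Dot \<Sigma>) A B"
  shows "F = G \<longleftrightarrow>
    (\<forall>S. hypergraph_functor (Dot \<Sigma>)
           (Mat :: ('u elem set, ('u, 'k::field_char_0) matrix) hypergraph_structure) S
         \<longrightarrow> OnArr S F = OnArr S G)"
proof
  assume *: "\<forall>S. hypergraph_functor (Dot \<Sigma>)
      (Mat :: ('u elem set, ('u, 'k) matrix) hypergraph_structure) S \<longrightarrow> OnArr S F = OnArr S G"
  obtain F' G' :: "('o, 'm, nat, nat) dot_diagram"
    where F': "F = dd_class \<Sigma> F'" "is_dot_diagram \<Sigma> F'" "has_boundary F' A B"
      and G': "G = dd_class \<Sigma> G'" "is_dot_diagram \<Sigma> G'" "has_boundary G' A B"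
    using assms(4,5) by (auto simp: Dot_def dot_hom_def)
  have "dd_isomorphic \<Sigma> F' G'"
  proof (rule isomorphic_if_card_homs_eq[OF F'(2,3) G'(2,3)])
    fix H :: "('o, 'm, nat, nat) dot_diagram"
    assume dH: "is_dot_diagram \<Sigma> H" and bH: "has_boundary H A B"
    interpret diagram_interpretation \<Sigma> H "TYPE('k)" "TYPE('u)"
      using dH by unfold_locales
    have "arr F = arr G"
      using *[rule_format, OF hypergraph_functor_sem] by (simp add: sem_def)
    moreover have "arr F = mk_matrix (ob A) (ob B) (\<lambda>x y. state_sum F' (untuple x) (untuple y))"
      "arr G = mk_matrix (ob A) (ob B) (\<lambda>x y. state_sum G' (untuple x) (untuple y))"
      unfolding F'(1) G'(1) using F' G' by (auto intro!: arr_eq denotes_dd_class)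
    \<comment> \<open>A single entry is inspected, the one indexed by the boundary dots of
      \<open>H\<close>.\<close>
    ultimately have "Entry (mk_matrix (ob A) (ob B) (\<lambda>x y. state_sum F' (untuple x) (untuple y)))
        (tuple (in_tuple H)) (tuple (out_tuple H)) =
      Entry (mk_matrix (ob A) (ob B) (\<lambda>x y. state_sum G' (untuple x) (untuple y)))
        (tuple (in_tuple H)) (tuple (out_tuple H))"
      by simp
    \<comment> \<open>Outside the index sets entries are 0 by convention; inside them the entry is
      the state sum.\<close>
    moreover have "(in_tuple H :: 'u elem list) \<in> tuples (dots_of H) A"
      "(out_tuple H :: 'u elem list) \<in> tuples (dots_of H) B"
      using dH bH by (rule boundary_tuples)+
    ultimately have "state_sum F' (in_tuple H) (out_tuple H) = state_sum G' (in_tuple H) (out_tuple H)"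
      by (simp add: Entry_mk_matrix)
    \<comment> \<open>Both state sums are \<open>of_nat\<close> of a count, and
      \<open>of_nat\<close> is injective in characteristic 0.\<close>
    then show "card (homs \<Sigma> F' H) = card (homs \<Sigma> G' H)"
      using bH F' G' by (simp add: state_sum_eq_card_homs)
  qed
  then show "F = G"
    using F' G' dd_class_eqI by blast
qed simp

end
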